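(* Let $G$ be the line graph of a constant-multiplicity multigraph. Then $G$ contains a totally odd strong immersion of the complete graph $K_{\chi(G)}$, where $\chi(G)$ denotes the chromatic number of $G$.
   Context: Graphs are finite, loopless and simple; multigraphs are finite and loopless but may have parallel edges. A multigraph has constant multiplicity if there is an integer $m\ge 1$ such that every two adjacent vertices are joined by exactly $m$ parallel edges (equivalently, it is obtained from a simple graph by replacing each edge with $m$ parallel edges). The line graph $L(H)$ of a multigraph $H$ is the simple graph whose vertices are the edges of $H$, where two distinct edges of $H$ are adjacent in $L(H)$ if they share at least one endpoint (so parallel edges are adjacent). A graph $G$ contains a graph $H$ as an immersion if there is an injective function $\phi\colon V(H)\to V(G)$ such that: (I) for every $uv\in E(H)$ there is a path $P_{uv}$ in $G$ with endpoints $\phi(u)$ and $\phi(v)$; and (II) the paths in $\{P_{uv}\mid uv\in E(H)\}$ are pairwise edge-disjoint. The vertices in $\phi(V(H))$ are the terminals of the immersion. The immersion is strong if no terminal appears as an interior vertex of any path $P_{uv}$. An immersion (or strong immersion) is totally odd if every path $P_{uv}$ is odd, i.e. has an odd number of edges. *)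

theory Defs
  imports Main
begin

record 'v ugraph =
  verts :: "'v set"
  edges :: "'v set set"

definition simple_graph :: "'v ugraph \<Rightarrow> bool" where
  "simple_graph G \<longleftrightarrow>
     finite (verts G) \<and> (\<forall>e\<in>edges G. e \<subseteq> verts G \<and> card e = 2)"

text \<open>Edges of a multigraph are objects of their own; distinct edges with the same
  set of endpoints are parallel.\<close>

record ('v, 'e) multigraph =
  mverts :: "'v set"
  medges :: "'e set"
  ends :: "'e \<Rightarrow> 'v set"

definition loopless_multigraph :: "('v, 'e) multigraph \<Rightarrow> bool" where
  "loopless_multigraph H \<longleftrightarrow>
     finite (mverts H) \<and> finite (medges H) \<and>
     (\<forall>e\<in>medges H. ends H e \<subseteq> mverts H \<and> card (ends H e) = 2)"

definition parallel_edges :: "('v, 'e) multigraph \<Rightarrow> 'v \<Rightarrow> 'v \<Rightarrow> 'e set" where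
  "parallel_edges H u v = {e \<in> medges H. ends H e = {u, v}}"

definition constant_multiplicity :: "('v, 'e) multigraph \<Rightarrow> bool" where
  "constant_multiplicity H \<longleftrightarrow>
     (\<exists>m\<ge>1. \<forall>u\<in>mverts H. \<forall>v\<in>mverts H.
        parallel_edges H u v \<noteq> {} \<longrightarrow> card (parallel_edges H u v) = m)"

definition line_graph :: "('v, 'e) multigraph \<Rightarrow> 'e ugraph" where
  "line_graph H =
     \<lparr>verts = medges H,
      edges = {{e, f} | e f. e \<in> medges H \<and> f \<in> medges H \<and> e \<noteq> f \<and>
                             ends H e \<inter> ends H f \<noteq> {}}\<rparr>"

definition complete_graph :: "nat \<Rightarrow> nat ugraph" where
  "complete_graph n =
     \<lparr>verts = {..<n}, edges = {{i, j} | i j. i < n \<and> j < n \<and> i \<noteq> j}\<rparr>"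

definition proper_colouring :: "'v ugraph \<Rightarrow> nat \<Rightarrow> ('v \<Rightarrow> nat) \<Rightarrow> bool" where
  "proper_colouring G k c \<longleftrightarrow>
     c ` verts G \<subseteq> {..<k} \<and> (\<forall>u v. {u, v} \<in> edges G \<longrightarrow> c u \<noteq> c v)"

definition chromatic_number :: "'v ugraph \<Rightarrow> nat" where
  "chromatic_number G = (LEAST k. \<exists>c. proper_colouring G k c)"

text \<open>Paths are given by their nonempty sequence of distinct vertices.\<close>

definition is_path :: "'v ugraph \<Rightarrow> 'v list \<Rightarrow> bool" where
  "is_path G p \<longleftrightarrow>
     p \<noteq> [] \<and> distinct p \<and> set p \<subseteq> verts G \<and>
     (\<forall>i. Suc i < length p \<longrightarrow> {p ! i, p ! Suc i} \<in> edges G)"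

definition path_edges :: "'v list \<Rightarrow> 'v set set" where
  "path_edges p = {{p ! i, p ! Suc i} | i. Suc i < length p}"

definition path_length :: "'v list \<Rightarrow> nat" where
  "path_length p = length p - 1"

definition interior :: "'v list \<Rightarrow> 'v set" where
  "interior p = set (butlast (tl p))"

text \<open>The paths are indexed by the edges of \<open>H\<close>, which are unordered pairs, so the
  endpoints of a path are prescribed as an unordered pair too.\<close>

definition immersion ::
  "'h ugraph \<Rightarrow> 'v ugraph \<Rightarrow> ('h \<Rightarrow> 'v) \<Rightarrow> ('h set \<Rightarrow> 'v list) \<Rightarrow> bool" where
  "immersion H G \<phi> P \<longleftrightarrow>
     inj_on \<phi> (verts H) \<and> \<phi> ` verts H \<subseteq> verts G \<and>
     (\<forall>e\<in>edges H. is_path G (P e) \<and> {hd (P e), last (P e)} = \<phi> ` e) \<and>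
     (\<forall>e\<in>edges H. \<forall>f\<in>edges H. e \<noteq> f \<longrightarrow> path_edges (P e) \<inter> path_edges (P f) = {})"

definition strong_immersion ::
  "'h ugraph \<Rightarrow> 'v ugraph \<Rightarrow> ('h \<Rightarrow> 'v) \<Rightarrow> ('h set \<Rightarrow> 'v list) \<Rightarrow> bool" where
  "strong_immersion H G \<phi> P \<longleftrightarrow>
     immersion H G \<phi> P \<and> (\<forall>e\<in>edges H. interior (P e) \<inter> \<phi> ` verts H = {})"

definition totally_odd :: "'h ugraph \<Rightarrow> ('h set \<Rightarrow> 'v list) \<Rightarrow> bool" where
  "totally_odd H P \<longleftrightarrow> (\<forall>e\<in>edges H. odd (path_length (P e)))"

definition contains_totally_odd_strong_immersion ::
  "'v ugraph \<Rightarrow> 'h ugraph \<Rightarrow> bool" where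
  "contains_totally_odd_strong_immersion G H \<longleftrightarrow>
     (\<exists>\<phi> P. strong_immersion H G \<phi> P \<and> totally_odd H P)"

lemma simple_graph_line_graph:
  "loopless_multigraph H \<Longrightarrow> simple_graph (line_graph H)"
  by (auto simp: loopless_multigraph_def simple_graph_def line_graph_def)

lemma simple_graph_complete_graph: "simple_graph (complete_graph n)"
  by (auto simp: simple_graph_def complete_graph_def)

lemma card_edges_path:
  assumes "distinct p"
  shows "card (path_edges p) = path_length p"
proof -
  have "inj_on (\<lambda>i. {p ! i, p ! Suc i}) {i. Suc i < length p}"
  proof (rule inj_onI)
    fix i j
    assume "i \<in> {i. Suc i < length p}" "j \<in> {i. Suc i < length p}"
      and eq: "{p ! i, p ! Suc i} = {p ! j, p ! Suc j}"
    then have i: "i < length p" "Suc i < length p" and j: "j < length p" "Suc j < length p"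
      by simp_all
    from eq have "p ! i = p ! j \<or> p ! i = p ! Suc j \<and> p ! Suc i = p ! j"
      unfolding doubleton_eq_iff by blast
    then have "i = j \<or> i = Suc j \<and> Suc i = j"
      using nth_eq_iff_index_eq[OF assms] i j by simp
    then show "i = j" by linarith
  qed
  moreover have "path_edges p = (\<lambda>i. {p ! i, p ! Suc i}) ` {i. Suc i < length p}"
    by (auto simp: path_edges_def)
  moreover have "{i. Suc i < length p} = {..<length p - 1}" by auto
  ultimately show ?thesis by (simp add: card_image path_length_def)
qed

lemma proper_colouring_chromatic_number:
  assumes "simple_graph G"
  shows "\<exists>c. proper_colouring G (chromatic_number G) c"
proof -
  have "finite (verts G)"
    using assms by (simp add: simple_graph_def)
  from ex_bij_betw_finite_nat[OF this]
  obtain c where "bij_betw c (verts G) {0..<card (verts G)}" ..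
  then have c: "c ` verts G = {..<card (verts G)}" "inj_on c (verts G)"
    by (simp_all add: bij_betw_def atLeast0LessThan)
  have "c u \<noteq> c v" if "{u, v} \<in> edges G" for u v
  proof -
    have uv: "{u, v} \<subseteq> verts G" "card {u, v} = 2"
      using that assms unfolding simple_graph_def by blast+
    from uv(2) have "u \<noteq> v" by auto
    with uv(1) c(2) show ?thesis by (simp add: inj_on_eq_iff)
  qed
  with c(1) have "proper_colouring G (card (verts G)) c"
    by (simp add: proper_colouring_def)
  then have "\<exists>k c. proper_colouring G k c" by iprover
  then show ?thesis
    unfolding chromatic_number_def by (rule LeastI_ex)
qed

end

theory Submission
  imports Defs
begin

text \<open>An odd path joining two terminals lifts to the graph in which every vertex is replaced by \<open>m\<close>
  adjacent copies: between the \<open>i\<close>-th copy of one end and the \<open>j\<close>-th copy of the other, use copies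
  \<open>i\<close> and \<open>j\<close> alternately. For different \<open>(i, j)\<close> these lifts are edge-disjoint. Since multiplying
  all edges by \<open>m\<close> multiplies the chromatic number of the line graph by at most \<open>m\<close>, it suffices to
  treat simple graphs.

  Let \<open>\<Delta>\<close> be the maximum degree of a simple graph. If it has a proper edge colouring with \<open>\<Delta>\<close> colours,
  then a star is the required clique. Otherwise Vizing's theorem gives \<open>\<Delta> + 1\<close> colours, and we may
  pass to a critical subgraph. There, by Vizing's fan argument, every vertex has at least two
  neighbours of degree \<open>\<Delta>\<close>, so a set containing exactly one vertex of degree \<open>\<Delta>\<close> is
  left by at least \<open>\<Delta>\<close> edges. Uncrossing minimum cuts yields two vertices \<open>x\<close>, \<open>y\<close> of degree \<open>\<Delta>\<close>
  that no fewer than \<open>\<Delta>\<close> edges separate, and Menger's theorem in the line graph gives \<open>\<Delta>\<close> disjoint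
  paths between their stars (this is Thomassen's theorem). The clique is formed by the star
  of \<open>x\<close> and one edge at \<open>y\<close>, after the parities of the paths have been corrected by
  detours through third edges at the neighbours of \<open>x\<close>.\<close>

subsection \<open>Fans and Kempe chains\<close>

text \<open>A simple graph is represented by its edge set alone. Isolated vertices do not affect the
  line graph.\<close>

definition simple_edges :: "'v set set \<Rightarrow> bool" where
  "simple_edges E \<longleftrightarrow> finite E \<and> (\<forall>e\<in>E. card e = 2)"

definition star :: "'v set set \<Rightarrow> 'v \<Rightarrow> 'v set set" where
  "star E v = {e \<in> E. v \<in> e}"

abbreviation deg :: "'v set set \<Rightarrow> 'v \<Rightarrow> nat" where
  "deg E v \<equiv> card (star E v)"

definition edge_col :: "'v set set \<Rightarrow> nat \<Rightarrow> ('v set \<Rightarrow> nat) \<Rightarrow> bool" where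
  "edge_col E k c \<longleftrightarrow>
     c ` E \<subseteq> {..<k} \<and> (\<forall>e\<in>E. \<forall>f\<in>E. e \<noteq> f \<longrightarrow> e \<inter> f \<noteq> {} \<longrightarrow> c e \<noteq> c f)"

definition edge_colourable :: "'v set set \<Rightarrow> nat \<Rightarrow> bool" where
  "edge_colourable E k \<longleftrightarrow> (\<exists>c. edge_col E k c)"

definition missing :: "'v set set \<Rightarrow> nat \<Rightarrow> ('v set \<Rightarrow> nat) \<Rightarrow> 'v \<Rightarrow> nat \<Rightarrow> bool" where
  "missing E k c v a \<longleftrightarrow> a < k \<and> (\<forall>e\<in>E. v \<in> e \<longrightarrow> c e \<noteq> a)"

lemma simple_edges_subset: "simple_edges E \<Longrightarrow> F \<subseteq> E \<Longrightarrow> simple_edges F"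
  by (auto simp: simple_edges_def intro: finite_subset)

lemma simple_edges_doubleton: "simple_edges E \<Longrightarrow> e \<in> E \<Longrightarrow> v \<in> e \<Longrightarrow> \<exists>w. w \<noteq> v \<and> e = {v, w}"
  by (auto simp: simple_edges_def card_2_iff)

lemma simple_edges_eqI:
  assumes "simple_edges E" "e \<in> E" "f \<in> E" "u \<noteq> v" "{u, v} \<subseteq> e" "{u, v} \<subseteq> f"
  shows "e = f"
  using assms by (auto simp: simple_edges_def card_2_iff)

lemma finite_star [simp]: "finite E \<Longrightarrow> finite (star E v)"
  by (simp add: star_def)

lemma edge_colD: "edge_col E k c \<Longrightarrow> e \<in> E \<Longrightarrow> f \<in> E \<Longrightarrow> c e = c f \<Longrightarrow> v \<in> e \<Longrightarrow> v \<in> f \<Longrightarrow> e = f"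
  by (auto simp: edge_col_def)

lemma exists_missing:
  assumes "finite E" "deg E v < k"
  shows "\<exists>a. missing E k c v a"
proof -
  have "card (c ` star E v) < card {..<k}"
    using card_image_le[OF finite_star[OF assms(1)], of c v] assms(2) by simp
  then have "\<not> {..<k} \<subseteq> c ` star E v"
    by (metis assms(1) card_mono finite_imageI finite_star linorder_not_le)
  then show ?thesis by (auto simp: missing_def star_def)
qed

lemma edge_colourable_insert:
  assumes "edge_col F k c" "missing F k c u a" "missing F k c w a"
  shows "edge_colourable (insert {u, w} F) k"
proof -
  have "edge_col (insert {u, w} F) k (c({u, w} := a))"
    using assms by (auto simp: edge_col_def missing_def)
  then show ?thesis by (auto simp: edge_colourable_def)
qed

text \<open>A Vizing fan with centre \<open>u\<close>. In use the edge from \<open>u\<close> to the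
  first vertex is the uncoloured one, so the conditions begin with the second vertex.\<close>

fun fan :: "'v set set \<Rightarrow> nat \<Rightarrow> ('v set \<Rightarrow> nat) \<Rightarrow> 'v \<Rightarrow> 'v list \<Rightarrow> bool" where
  "fan E k c u (w # w' # ws) \<longleftrightarrow>
     {u, w'} \<in> E \<and> missing E k c w (c {u, w'}) \<and> fan E k c u (w' # ws)"
| "fan E k c u _ \<longleftrightarrow> True"

lemma fan_cong:
  assumes "fan E k c u ws"
    and "\<And>w w'. w \<in> set ws \<Longrightarrow> w' \<in> set (tl ws) \<Longrightarrow> {u, w'} \<in> E \<Longrightarrow> missing E k c w (c {u, w'}) \<Longrightarrow>
           {u, w'} \<in> E' \<and> missing E' k c' w (c' {u, w'})"
  shows "fan E' k c' u ws"
  using assms by (induction E k c u ws rule: fan.induct) auto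

lemma fan_append: "fan E k c u (xs @ ys) \<Longrightarrow> fan E k c u ys"
proof (induction xs)
  case (Cons x xs)
  then show ?case by (cases "xs @ ys") auto
qed simp

lemma fan_edges: "fan E k c u (w # ws) \<Longrightarrow> w' \<in> set ws \<Longrightarrow> {u, w'} \<in> E"
  by (induction ws arbitrary: w) auto

lemma fan_missing: "fan E k c u (xs @ w # w' # ys) \<Longrightarrow> missing E k c w (c {u, w'})"
  using fan_append by fastforce

lemma fan_snoc:
  "fan E k c u (ws @ [w]) \<Longrightarrow> {u, w'} \<in> E \<Longrightarrow> missing E k c w (c {u, w'}) \<Longrightarrow> fan E k c u (ws @ [w, w'])"
proof (induction ws)
  case (Cons a ws)
  then show ?case by (cases ws) auto
qed simp

text \<open>The uncoloured edge moves one place along the fan: \<open>{u, w}\<close> takes over the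
  colour of \<open>{u, w'}\<close>, which is missing at \<open>w\<close> and becomes free at
  \<open>u\<close>. Only \<open>w\<close> can lose a missing colour, so the rest of the fan
  survives.\<close>

lemma rotate_fan:
  assumes col: "edge_col F k c" and F: "{u, w} \<notin> F"
    and fan: "fan F k c u (w # w' # ws)" and dist: "distinct (w # w' # ws)"
    and u: "u \<notin> set (w # w' # ws)"
  defines "F' \<equiv> insert {u, w} (F - {{u, w'}})" and "c' \<equiv> c({u, w} := c {u, w'})"
  shows "edge_col F' k c'" "fan F' k c' u (w' # ws)" "{u, w'} \<notin> F'"
    "insert {u, w'} F' = insert {u, w} F"
    "\<And>v a. v \<noteq> w \<Longrightarrow> missing F k c v a \<Longrightarrow> missing F' k c' v a"
    "\<And>x. x \<noteq> w \<Longrightarrow> c' {u, x} = c {u, x}"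
proof -
  have e: "{u, w'} \<in> F" and m: "missing F k c w (c {u, w'})"
    using fan by auto
  have ne: "{u, w} \<noteq> {u, w'}" using dist by (auto simp: doubleton_eq_iff)
  have uw': "c f \<noteq> c {u, w'}" if "f \<in> F" "f \<noteq> {u, w'}" "u \<in> f" for f
    using edge_colD[OF col that(1) e _ that(3)] that by auto
  have wm: "c f \<noteq> c {u, w'}" if "f \<in> F" "w \<in> f" for f
    using m that by (auto simp: missing_def)
  show "edge_col F' k c'"
    unfolding edge_col_def
  proof (intro conjI ballI impI)
    show "c' ` F' \<subseteq> {..<k}" using col e by (auto simp: edge_col_def F'_def c'_def)
    fix f g assume fg: "f \<in> F'" "g \<in> F'" "f \<noteq> g" "f \<inter> g \<noteq> {}"
    have old: "c f \<noteq> c {u, w'}" if "f \<in> F" "f \<noteq> {u, w'}" "f \<inter> {u, w} \<noteq> {}" for f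
      using uw'[of f] wm[of f] that by blast
    show "c' f \<noteq> c' g"
    proof (cases "f = {u, w} \<or> g = {u, w}")
      case True
      then show ?thesis
      proof
        assume f: "f = {u, w}"
        then have "g \<noteq> {u, w}" "g \<in> F" "g \<noteq> {u, w'}" "g \<inter> {u, w} \<noteq> {}"
          using fg by (auto simp: F'_def)
        then show ?thesis using old[of g] by (simp add: c'_def f)
      next
        assume g: "g = {u, w}"
        then have "f \<noteq> {u, w}" "f \<in> F" "f \<noteq> {u, w'}" "f \<inter> {u, w} \<noteq> {}"
          using fg by (auto simp: F'_def)
        then show ?thesis using old[of f] by (simp add: c'_def g)
      qed
    next
      case False
      then have "f \<in> F" "g \<in> F" using fg by (auto simp: F'_def)
      then show ?thesis using False fg col by (simp add: c'_def edge_col_def)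
    qed
  qed
  show miss: "missing F' k c' v a" if "v \<noteq> w" "missing F k c v a" for v a
    using that e ne by (auto simp: missing_def F'_def c'_def)
  show c': "c' {u, x} = c {u, x}" if "x \<noteq> w" for x
    using that by (auto simp: c'_def doubleton_eq_iff)
  show "{u, w'} \<notin> F'" using ne by (auto simp: F'_def)
  show "insert {u, w'} F' = insert {u, w} F" using e by (auto simp: F'_def)
  have "fan F k c u (w' # ws)" using fan by simp
  then show "fan F' k c' u (w' # ws)"
  proof (rule fan_cong)
    fix x y assume "x \<in> set (w' # ws)" and y: "y \<in> set (tl (w' # ws))" "{u, y} \<in> F"
      and m: "missing F k c x (c {u, y})"
    then have "x \<noteq> w" "y \<noteq> w" using dist by auto
    moreover have "y \<noteq> w'" using y dist by auto
    then have "{u, y} \<in> F'" using y by (auto simp: F'_def doubleton_eq_iff)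
    ultimately show "{u, y} \<in> F' \<and> missing F' k c' x (c' {u, y})"
      using miss m c' by auto
  qed
qed

text \<open>Rotating through the whole fan leaves the edge to its last vertex uncoloured, and
  \<open>a\<close> is still missing at both of its ends.\<close>

lemma fan_colourable:
  assumes "edge_col F k c" "fan F k c u ws" "ws \<noteq> []" "distinct ws" "u \<notin> set ws"
    and "{u, hd ws} \<notin> F" "missing F k c u a" "missing F k c (last ws) a"
  shows "edge_colourable (insert {u, hd ws} F) k"
  using assms
proof (induction ws arbitrary: F c)
  case (Cons w ws)
  show ?case
  proof (cases ws)
    case Nil
    then show ?thesis using Cons.prems edge_colourable_insert[of F k c u a w] by simp
  next
    case (Cons w' ws')
    have p: "edge_col F k c" "{u, w} \<notin> F" "fan F k c u (w # w' # ws')"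
      "distinct (w # w' # ws')" "u \<notin> set (w # w' # ws')"
      using Cons.prems by (simp_all add: Cons)
    note r = rotate_fan[OF p]
    have l: "last ws \<noteq> w" using Cons.prems Cons by (metis distinct.simps(2) last_in_set list.distinct(1))
    have "u \<noteq> w" using p by simp
    then have "edge_colourable (insert {u, hd ws} (insert {u, w} (F - {{u, w'}}))) k"
      using Cons.prems l r(2,3) unfolding Cons
      by (intro Cons.IH[OF r(1), unfolded Cons]) (auto intro!: r(5) simp del: fun_upd_apply)
    then show ?thesis using r(4) Cons by simp
  qed
qed simp

text \<open>Iterated rotation along \<open>xs\<close>. The term \<open>hd (xs @ [w])\<close> is the
  first vertex of the fan even when \<open>xs\<close> is empty.\<close>

lemma fan_rotate_to:
  assumes "edge_col F k c" "fan F k c u (xs @ w # ws)" "distinct (xs @ w # ws)"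
    "u \<notin> set (xs @ w # ws)" "{u, hd (xs @ [w])} \<notin> F"
  shows "\<exists>F' c'. edge_col F' k c' \<and> fan F' k c' u (w # ws) \<and> {u, w} \<notin> F' \<and>
     insert {u, w} F' = insert {u, hd (xs @ [w])} F \<and>
     (\<forall>v a. v \<notin> set xs \<longrightarrow> missing F k c v a \<longrightarrow> missing F' k c' v a) \<and>
     (\<forall>y. y \<notin> set xs \<longrightarrow> c' {u, y} = c {u, y})"
  using assms
proof (induction xs arbitrary: F c)
  case Nil
  then show ?case by auto
next
  case (Cons x xs)
  obtain w' zs where w': "xs @ w # ws = w' # zs" "hd (xs @ [w]) = w'"
    by (cases xs) auto
  let ?F = "insert {u, x} (F - {{u, w'}})" and ?c = "c({u, x} := c {u, w'})"
  have p: "edge_col F k c" "{u, x} \<notin> F" "fan F k c u (x # w' # zs)" "distinct (x # w' # zs)"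
    "u \<notin> set (x # w' # zs)"
    using Cons.prems by (simp_all flip: w'(1))
  note r = rotate_fan[OF p]
  have *: "distinct (xs @ w # ws)" "u \<notin> set (xs @ w # ws)" using Cons.prems by auto
  have "fan ?F k ?c u (xs @ w # ws)" "{u, hd (xs @ [w])} \<notin> ?F"
    using r(2,3) w' by simp_all
  then obtain F' c' where "edge_col F' k c'" "fan F' k c' u (w # ws)" "{u, w} \<notin> F'"
     "insert {u, w} F' = insert {u, w'} ?F"
     "\<And>v a. v \<notin> set xs \<Longrightarrow> missing ?F k ?c v a \<Longrightarrow> missing F' k c' v a"
     "\<And>y. y \<notin> set xs \<Longrightarrow> c' {u, y} = ?c {u, y}"
    using Cons.IH[OF r(1) _ *] unfolding w'(2) by blast
  moreover have "hd ((x # xs) @ [w]) = x" by simp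
  ultimately show ?case
    using r(4-6) by (intro exI[of _ F'] exI[of _ c']) auto
qed

section \<open>Kempe changes\<close>

definition kempe_closed :: "'v set set \<Rightarrow> ('v set \<Rightarrow> nat) \<Rightarrow> nat \<Rightarrow> nat \<Rightarrow> 'v set \<Rightarrow> bool" where
  "kempe_closed E c a b X \<longleftrightarrow> (\<forall>e\<in>E. c e \<in> {a, b} \<longrightarrow> e \<inter> X \<noteq> {} \<longrightarrow> e \<subseteq> X)"

definition swap :: "nat \<Rightarrow> nat \<Rightarrow> nat \<Rightarrow> nat" where
  "swap a b i = (if i = a then b else if i = b then a else i)"

text \<open>An edge coloured \<open>a\<close> or \<open>b\<close> that meets a closed
  \<open>X\<close> lies inside it, and \<open>swap\<close> fixes all other colours; so edges
  crossing the boundary of \<open>X\<close> keep their colours.\<close>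

definition kempe_swap :: "('v set \<Rightarrow> nat) \<Rightarrow> nat \<Rightarrow> nat \<Rightarrow> 'v set \<Rightarrow> 'v set \<Rightarrow> nat" where
  "kempe_swap c a b X e = (if e \<inter> X \<noteq> {} then swap a b (c e) else c e)"

lemma swap_simps [simp]:
  "swap a b a = b" "swap a b b = a" "i \<noteq> a \<Longrightarrow> i \<noteq> b \<Longrightarrow> swap a b i = i"
  "swap a b i = swap a b j \<longleftrightarrow> i = j" "swap a b (swap a b i) = i"
  by (auto simp: swap_def)

lemma swap_less: "a < k \<Longrightarrow> b < k \<Longrightarrow> swap a b i < k \<longleftrightarrow> i < k"
  by (auto simp: swap_def)

text \<open>Exchanging colours off a chain instead of on it keeps the colours at its start.\<close>

lemma kempe_closed_Compl: "kempe_closed E c a b X \<Longrightarrow> kempe_closed E c a b (- X)"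
  by (auto simp: kempe_closed_def)

lemma kempe_swap_at:
  assumes "kempe_closed E c a b X" "e \<in> E" "v \<in> e"
  shows "kempe_swap c a b X e = (if v \<in> X then swap a b (c e) else c e)"
  using assms unfolding kempe_closed_def kempe_swap_def swap_def by auto

lemma edge_col_kempe_swap:
  assumes X: "kempe_closed E c a b X" and c: "edge_col E k c" and ab: "a < k" "b < k"
  shows "edge_col E k (kempe_swap c a b X)"
  unfolding edge_col_def
proof (intro conjI ballI impI)
  show "kempe_swap c a b X ` E \<subseteq> {..<k}"
    using c ab by (auto simp: edge_col_def kempe_swap_def swap_less)
  fix e f assume ef: "e \<in> E" "f \<in> E" "e \<noteq> f" "e \<inter> f \<noteq> {}"
  then obtain v where v: "v \<in> e" "v \<in> f" by auto
  have "c e \<noteq> c f" using edge_colD[OF c ef(1,2) _ v] ef by auto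
  then show "kempe_swap c a b X e \<noteq> kempe_swap c a b X f"
    using kempe_swap_at[OF X ef(1) v(1)] kempe_swap_at[OF X ef(2) v(2)] by auto
qed

lemma missing_kempe_swap:
  assumes X: "kempe_closed E c a b X" and ab: "a < k" "b < k"
  shows "missing E k (kempe_swap c a b X) v i \<longleftrightarrow>
    missing E k c v (if v \<in> X then swap a b i else i)"
proof -
  have "swap a b j \<noteq> i \<longleftrightarrow> j \<noteq> swap a b i" for j
    by (metis swap_simps(5))
  then show ?thesis
    using kempe_swap_at[OF X, of _ v] ab unfolding missing_def by (auto simp: swap_less)
qed

text \<open>The set below consists of the vertices of the alternating path that starts at \<open>u\<close>; a state
  is a vertex together with the colour by which the path is about to leave it. Moving between
  states is deterministic, so the path has only one other end.\<close>

lemma kempe_chain: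
  assumes E: "simple_edges E" and c: "edge_col E k c" and ua: "missing E k c u a" and ab: "a \<noteq> b"
  shows "\<exists>X. u \<in> X \<and> kempe_closed E c a b X \<and>
    (\<forall>v\<in>X. \<forall>w\<in>X. v \<noteq> u \<longrightarrow> w \<noteq> u \<longrightarrow>
       missing E k c v a \<or> missing E k c v b \<longrightarrow>
       missing E k c w a \<or> missing E k c w b \<longrightarrow> v = w)"
proof -
  define R where "R = {((v, i), (w, j)). {v, w} \<in> E \<and> v \<noteq> w \<and> c {v, w} = i \<and>
     i \<in> {a, b} \<and> j = swap a b i}"
  \<comment> \<open>As \<open>a\<close> is missing at \<open>u\<close>, the path leaves
    \<open>u\<close> by colour \<open>b\<close>.\<close>
  define X where "X = {v. \<exists>i. ((u, b), (v, i)) \<in> R\<^sup>*}"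
  have sv: "single_valued R"
  proof (rule single_valuedI, clarify)
    fix v i w j w' j'
    assume "((v, i), (w, j)) \<in> R" "((v, i), (w', j')) \<in> R"
    moreover from this have "{v, w} = {v, w'}"
      using edge_colD[OF c, of "{v, w}" "{v, w'}" v] by (auto simp: R_def)
    ultimately show "w = w' \<and> j = j'" by (auto simp: R_def doubleton_eq_iff)
  qed
  have st: "i \<in> {a, b} \<and>
     (v = u \<and> i = b \<or> (\<exists>w. w \<in> X \<and> {v, w} \<in> E \<and> c {v, w} = swap a b i))"
    if "((u, b), (v, i)) \<in> R\<^sup>*" for v i
    using that
  proof (cases rule: rtranclE)
    case (step y)
    then show ?thesis by (cases y) (auto simp: R_def X_def insert_commute)
  qed auto
  have uX: "u \<in> X" by (auto simp: X_def)
  have "kempe_closed E c a b X"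
    unfolding kempe_closed_def
  proof (intro ballI impI)
    fix e assume e: "e \<in> E" "c e \<in> {a, b}" "e \<inter> X \<noteq> {}"
    then obtain v where v: "v \<in> X" "v \<in> e" by auto
    then obtain w where w: "w \<noteq> v" "e = {v, w}" using simple_edges_doubleton E e by metis
    from v obtain i where i: "((u, b), (v, i)) \<in> R\<^sup>*" by (auto simp: X_def)
    have "w \<in> X"
    proof (cases "c e = i")
      case True
      then have "((v, i), (w, swap a b i)) \<in> R" using e w by (auto simp: R_def)
      then show ?thesis using i unfolding X_def by (blast intro: rtrancl_into_rtrancl)
    next
      case False
      \<comment> \<open>The edge \<open>e\<close> has the arrival colour. So it is the edge by which
        the path came to \<open>v\<close>, or \<open>v\<close> is the start, where that colour is
        \<open>a\<close> and hence missing.\<close>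
      then have ci: "c e = swap a b i" using st[OF i] e by auto
      consider "v = u" "i = b" | w' where "w' \<in> X" "{v, w'} \<in> E" "c {v, w'} = swap a b i"
        using st[OF i] by auto
      then show ?thesis
      proof cases
        case 1
        then show ?thesis using ua e v ci by (auto simp: missing_def)
      next
        case 2
        then have "{v, w'} = {v, w}" using edge_colD[OF c, of "{v, w'}" e v] e w ci by auto
        then show ?thesis using 2 by (metis doubleton_eq_iff)
      qed
    qed
    then show "e \<subseteq> X" using w v by auto
  qed
  moreover have "v = w" if vw: "v \<in> X" "w \<in> X" "v \<noteq> u" "w \<noteq> u"
    "missing E k c v a \<or> missing E k c v b" "missing E k c w a \<or> missing E k c w b" for v w
  proof -
    \<comment> \<open>The arrival colour occurs at \<open>x\<close>, so the missing one is the
      departure colour and the path stops there.\<close>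
    have end_state: "(x, i) \<notin> Domain R"
      if x: "((u, b), (x, i)) \<in> R\<^sup>*" "x \<noteq> u" "missing E k c x a \<or> missing E k c x b" for x i
    proof -
      have "i \<in> {a, b}" "\<exists>w. {x, w} \<in> E \<and> c {x, w} = swap a b i" using st[OF x(1)] x(2) by auto
      then have "missing E k c x i"
        using x(3) by (auto simp: missing_def swap_def split: if_splits)
      then show ?thesis by (auto simp: R_def missing_def)
    qed
    obtain i j where ij: "((u, b), (v, i)) \<in> R\<^sup>*" "((u, b), (w, j)) \<in> R\<^sup>*"
      using vw by (auto simp: X_def)
    \<comment> \<open>By determinism one of the two states is reached from the other; both are dead
      ends, hence equal.\<close>
    then have "((v, i), (w, j)) \<in> R\<^sup>* \<or> ((w, j), (v, i)) \<in> R\<^sup>*"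
      by (rule single_valued_confluent[OF sv])
    then show ?thesis
      using end_state[OF ij(1)] end_state[OF ij(2)] vw
      by (metis Domain.DomainI converse_rtranclE prod.inject)
  qed
  ultimately show ?thesis using uX by (intro exI[of _ X]) blast
qed

text \<open>Let \<open>a\<close> be missing at \<open>u\<close>. The chain of colours
  \<open>a\<close> and \<open>b\<close> from \<open>u\<close> cannot contain both \<open>w\<close>
  and \<open>last ws\<close>, which miss \<open>b\<close>. If it avoids \<open>w\<close>, exchanging
  along it frees \<open>b\<close> at both ends of the uncoloured edge. Otherwise exchanging off it
  makes \<open>a\<close> missing at \<open>last ws\<close>, and the fan can be rotated.\<close>

lemma fan_disjoint_missing:
  assumes E: "simple_edges (insert {u, w} F)" and col: "edge_col F k c"
    and F: "{u, w} \<notin> F" and fan: "fan F k c u (w # ws)" and dist: "distinct (w # ws)"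
    and u: "u \<notin> set (w # ws)" and ws: "ws \<noteq> []"
    and deg: "deg F u < k"
    and m: "missing F k c w b" "missing F k c (last ws) b"
    and b: "\<And>y. y \<in> set (tl ws) \<Longrightarrow> c {u, y} \<noteq> b"
  shows "edge_colourable (insert {u, w} F) k"
proof (rule ccontr)
  assume ncol: "\<not> edge_colourable (insert {u, w} F) k"
  have SF: "simple_edges F" using E simple_edges_subset by blast
  then obtain a where a: "missing F k c u a"
    using exists_missing[OF _ deg] by (auto simp: simple_edges_def)
  have ak: "a < k" "b < k" using a m by (auto simp: missing_def)
  have ab: "a \<noteq> b" using edge_colourable_insert[OF col a] m ncol by auto
  obtain X where X: "u \<in> X" "kempe_closed F c a b X"
    and X1: "\<And>v w. v \<in> X \<Longrightarrow> w \<in> X \<Longrightarrow> v \<noteq> u \<Longrightarrow> w \<noteq> u \<Longrightarrow>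
       missing F k c v b \<Longrightarrow> missing F k c w b \<Longrightarrow> v = w"
    using kempe_chain[OF SF col a ab] by blast
  have lw: "last ws \<in> set ws" "last ws \<noteq> w" "last ws \<noteq> u" "w \<noteq> u" using ws dist u by auto
  show False
  proof (cases "w \<in> X")
    case False
    have "missing F k (kempe_swap c a b X) u b" "missing F k (kempe_swap c a b X) w b"
      using missing_kempe_swap[OF X(2) ak] False X(1) a m by auto
    then show ?thesis
      using edge_colourable_insert[OF edge_col_kempe_swap[OF X(2) col ak]] ncol by blast
  next
    case True
    then have lX: "last ws \<notin> X" using X1[of w "last ws"] lw m by auto
    let ?c = "kempe_swap c a b (- X)"
    note Y = kempe_closed_Compl[OF X(2)]
    note ms = missing_kempe_swap[OF Y ak]
    have "missing F k ?c u a" "missing F k ?c (last ws) a"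
      using ms X(1) lX a m by auto
    \<comment> \<open>On the fan edges \<open>a\<close> does not occur, and \<open>b\<close> at most
      on the first coloured one, whose colour has to be missing only at \<open>w\<close>; since
      \<open>w\<close> lies on the chain, nothing changes there.\<close>
    moreover have "fan F k ?c u (w # ws)"
    proof -
      have cu: "?c {u, y} = c {u, y}" if "{u, y} \<in> F" for y
        using kempe_swap_at[OF Y that, of u] X(1) by auto
      have na: "c {u, y} \<noteq> a" if "{u, y} \<in> F" for y
        using a that by (auto simp: missing_def)
      obtain w' ws' where ws': "ws = w' # ws'" using ws by (cases ws) auto
      have "fan F k c u ws" using fan ws' by simp
      then have "fan F k ?c u ws"
      proof (rule fan_cong)
        fix x y assume "x \<in> set ws" "y \<in> set (tl ws)" "{u, y} \<in> F" "missing F k c x (c {u, y})"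
        then show "{u, y} \<in> F \<and> missing F k ?c x (?c {u, y})"
          using ms[of x "c {u, y}"] cu na b[of y] by auto
      qed
      then show ?thesis using fan ms[of w] True cu ws' by auto
    qed
    ultimately show ?thesis
      using fan_colourable[OF edge_col_kempe_swap[OF Y col ak], of u "w # ws" a] ncol F dist u ws
      by auto
  qed
qed

text \<open>Vizing's fan argument. In a longest fan from \<open>w\<close> the last vertex misses a
  colour \<open>b\<close>. If \<open>b\<close> is present at \<open>u\<close>, its edge
  \<open>{u, x}\<close> leads back into the fan, so the predecessor of \<open>x\<close> misses
  \<open>b\<close> as well, and \<open>fan_disjoint_missing\<close> applies to the part of the fan
  from that predecessor on.\<close>

lemma fan_extend_colourable:
  assumes E: "simple_edges E" and e: "{u, w} \<in> E"
    and col: "edge_colourable (E - {{u, w}}) k" and deg: "deg E u \<le> k" "deg E w \<le> k"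
    and nbr: "\<And>y. {u, y} \<in> E \<Longrightarrow> y \<noteq> w \<Longrightarrow> deg E y < k"
  shows "edge_colourable E k"
proof (rule ccontr)
  assume ncol: "\<not> edge_colourable E k"
  let ?F = "E - {{u, w}}"
  have fin: "finite E" using E by (simp add: simple_edges_def)
  obtain c where c: "edge_col ?F k c" using col by (auto simp: edge_colourable_def)
  have EF: "insert {u, w} ?F = E" using e by auto
  have uw: "u \<noteq> w" using E e by (auto simp: simple_edges_def)
  have d: "deg ?F v < k" if "v \<in> {u, w}" for v
  proof -
    have "star ?F v \<subset> star E v" using e that by (auto simp: star_def)
    then have "deg ?F v < deg E v" using fin by (simp add: psubset_card_mono)
    then show ?thesis using deg that by auto
  qed
  have dn: "deg ?F y < k" if "{u, y} \<in> E" for y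
  proof (cases "y = w")
    case False
    have "deg ?F y \<le> deg E y" by (rule card_mono) (auto simp: star_def fin)
    then show ?thesis using nbr[OF that False] by simp
  qed (use d in auto)
  define N where "N = {y. {u, y} \<in> E}"
  have "finite (\<Union>E)" using E unfolding simple_edges_def by (metis card.infinite finite_Union zero_neq_numeral)
  then have finN: "finite N" by (rule finite_subset[rotated]) (auto simp: N_def)
  define P where "P ws \<longleftrightarrow> ws \<noteq> [] \<and> hd ws = w \<and> distinct ws \<and> set ws \<subseteq> N \<and> fan ?F k c u ws" for ws
  have "P [w]" using e by (auto simp: P_def N_def)
  moreover have "\<forall>ws. P ws \<longrightarrow> length ws < Suc (card N)"
    unfolding P_def using finN by (metis card_mono distinct_card less_Suc_eq_le)
  ultimately obtain ws where ws: "P ws" and mx: "\<And>vs. P vs \<Longrightarrow> length vs \<le> length ws"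
    using ex_has_greatest_nat[of P "[w]" length] by blast
  note W = ws[unfolded P_def]
  have "last ws \<in> N" using W last_in_set by blast
  then have lN: "{u, last ws} \<in> E" by (simp add: N_def)
  obtain b where b: "missing ?F k c (last ws) b"
    using exists_missing[OF _ dn[OF lN]] fin by blast
  have uN: "u \<notin> N" using E by (auto simp: N_def simple_edges_def)
  then have uws: "u \<notin> set ws" using W by auto
  have "\<not> missing ?F k c u b"
    using fan_colourable[OF c, of u ws b] W uws b ncol EF by auto
  then obtain f where f: "f \<in> ?F" "u \<in> f" "c f = b" using b by (auto simp: missing_def)
  then obtain x where x: "f = {u, x}" using simple_edges_doubleton[OF E, of f u] by auto
  have xw: "x \<noteq> w" using f x by auto
  \<comment> \<open>Otherwise \<open>x\<close> could be appended to the longest fan.\<close>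
  have "x \<in> set ws"
  proof (rule ccontr)
    assume "x \<notin> set ws"
    moreover obtain vs where vs: "ws = vs @ [last ws]" using W by (metis append_butlast_last_id)
    have "fan ?F k c u (vs @ [last ws, x])"
      using fan_snoc[of ?F k c u vs "last ws" x] W b f x vs by auto
    then have "fan ?F k c u (ws @ [x])" by (subst vs) simp
    ultimately have "P (ws @ [x])" using W f x by (auto simp: P_def N_def)
    then show False using mx by fastforce
  qed
  then obtain ys zs where "ws = ys @ x # zs" by (metis split_list)
  moreover have "ys \<noteq> []" using W xw calculation by auto
  then obtain xs v where "ys = xs @ [v]" by (metis rev_exhaust)
  ultimately have ws': "ws = xs @ v # x # zs" by simp
  have hd: "hd (xs @ [v]) = w" using W ws' by (cases xs) auto
  have mv: "missing ?F k c v b" using fan_missing[of ?F k c u xs v x zs] W ws' f x by auto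
  \<comment> \<open>Rotation makes \<open>{u, v}\<close> the uncoloured edge; \<open>v\<close> and
    the last vertex lie outside \<open>xs\<close> and therefore keep missing
    \<open>b\<close>.\<close>
  obtain F' c' where F': "edge_col F' k c'" "fan F' k c' u (v # x # zs)" "{u, v} \<notin> F'"
    "insert {u, v} F' = E"
    "\<And>y a. y \<notin> set xs \<Longrightarrow> missing ?F k c y a \<Longrightarrow> missing F' k c' y a"
    "\<And>y. y \<notin> set xs \<Longrightarrow> c' {u, y} = c {u, y}"
    using fan_rotate_to[OF c, of u xs v "x # zs"] W uws hd EF unfolding ws' by auto
  have "edge_colourable (insert {u, v} F') k"
  proof (rule fan_disjoint_missing[OF _ F'(1,3,2)])
    show "simple_edges (insert {u, v} F')" using E F' by simp
    show "distinct (v # x # zs)" "u \<notin> set (v # x # zs)" using W uws ws' by auto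
    show "missing F' k c' v b" using F'(5)[OF _ mv] W ws' by auto
    have "last (x # zs) \<notin> set xs" using W ws' by (metis distinct_append disjoint_iff last_in_set list.distinct(1) list.set_intros(2))
    then show "missing F' k c' (last (x # zs)) b" using F'(5) b ws' by simp
    have "star F' u \<subset> star E u" using F'(3,4) by (auto simp: star_def)
    then have "deg F' u < deg E u" using fin by (simp add: psubset_card_mono)
    then show "deg F' u < k" using deg by simp
    \<comment> \<open>At \<open>u\<close> the colour \<open>b\<close> occurs only on
      \<open>{u, x}\<close>, the first coloured edge of the remaining fan.\<close>
    fix y assume y: "y \<in> set (tl (x # zs))"
    then have ym: "y \<noteq> x" "y \<notin> set xs" "y \<noteq> v" using W ws' by auto
    have yE: "{u, y} \<in> F'" using fan_edges[OF F'(2), of y] y by auto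
    have xE: "{u, x} \<in> F'" using F'(2) by simp
    have "c' {u, x} = b" using F'(6)[of x] W ws' f x by auto
    then show "c' {u, y} \<noteq> b"
      using edge_colD[OF F'(1) yE xE, of u] ym by (auto simp: doubleton_eq_iff)
  qed simp
  then show False using F'(4) ncol by simp
qed

text \<open>Insert the edges one at a time: with one colour more than the degree bound, the degree
  conditions of \<open>fan_extend_colourable\<close> always hold.\<close>

theorem Vizing:
  assumes "simple_edges E" "\<And>v. deg E v \<le> k"
  shows "edge_colourable E (Suc k)"
proof -
  have "finite E" using assms by (simp add: simple_edges_def)
  then show ?thesis using assms
  proof (induction E)
    case empty
    then show ?case by (auto simp: edge_colourable_def edge_col_def)
  next
    case (insert e E)
    obtain u w where e: "e = {u, w}" using insert.prems(1) by (auto simp: simple_edges_def card_2_iff)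
    have d: "deg E v \<le> k" for v
    proof -
      have "deg E v \<le> deg (insert e E) v" using insert.hyps by (intro card_mono) (auto simp: star_def)
      then show ?thesis using insert.prems(2)[of v] by simp
    qed
    have "edge_colourable E (Suc k)"
      using insert.IH[OF _ d] insert.prems(1) simple_edges_subset by blast
    then have c: "edge_colourable (insert e E - {{u, w}}) (Suc k)"
      using insert.hyps e by simp
    have "deg (insert e E) v \<le> Suc k" "deg (insert e E) v < Suc k" for v
      using insert.prems(2)[of v] by simp_all
    then show ?case
      using fan_extend_colourable[OF insert.prems(1) _ c] e by blast
  qed
qed

section \<open>Critical graphs\<close>

definition critical :: "'v set set \<Rightarrow> nat \<Rightarrow> bool" where
  "critical E k \<longleftrightarrow> simple_edges E \<and> (\<forall>v. deg E v \<le> k) \<and> \<not> edge_colourable E k \<and>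
     (\<forall>e\<in>E. edge_colourable (E - {e}) k)"

lemma exists_critical:
  assumes "simple_edges E" "\<And>v. deg E v \<le> k" "\<not> edge_colourable E k"
  shows "\<exists>F\<subseteq>E. critical F k"
proof -
  have fin: "finite E" using assms by (simp add: simple_edges_def)
  let ?P = "\<lambda>F. F \<subseteq> E \<and> \<not> edge_colourable F k"
  obtain F where F: "?P F" "\<And>F'. ?P F' \<Longrightarrow> card F \<le> card F'"
    using ex_has_least_nat[of ?P E card] assms by auto
  have finF: "finite F" using F fin finite_subset by blast
  have "edge_colourable (F - {e}) k" if "e \<in> F" for e
    using F(1) F(2)[of "F - {e}"] card_Diff1_less[OF finF that] by fastforce
  moreover have "deg F v \<le> k" for v
  proof -
    have "deg F v \<le> deg E v" using F fin by (intro card_mono) (auto simp: star_def)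
    then show ?thesis using assms(2)[of v] by simp
  qed
  ultimately show ?thesis
    using F simple_edges_subset[OF assms(1)] by (auto simp: critical_def)
qed

lemma critical_edge:
  assumes "critical E k"
  obtains u w where "{u, w} \<in> E" "u \<noteq> w"
proof -
  have E: "simple_edges E" using assms by (simp add: critical_def)
  have "E \<noteq> {}"
  proof
    assume "E = {}"
    then have "edge_colourable E k" by (simp add: edge_colourable_def edge_col_def)
    then show False using assms by (simp add: critical_def)
  qed
  then show ?thesis using E that by (fastforce simp: simple_edges_def card_2_iff)
qed

text \<open>A form of Vizing's adjacency lemma: if all neighbours of \<open>u\<close> other than
  \<open>w\<close> had degree below \<open>k\<close>, a colouring without \<open>{u, w}\<close>
  could be extended. A second application, to the neighbour found, yields two neighbours of degree
  \<open>k\<close>.\<close>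

lemma critical_neighbour:
  assumes "critical E k" "{u, w} \<in> E"
  shows "\<exists>y. y \<noteq> w \<and> {u, y} \<in> E \<and> deg E y = k"
  using fan_extend_colourable[of E u w k] assms unfolding critical_def
  by (metis le_neq_implies_less)

text \<open>Delete \<open>{u, w}\<close>, colour the rest and let \<open>a\<close> be missing at
  \<open>u\<close>. The one edge left at \<open>w\<close> must be coloured \<open>a\<close>, so
  \<open>w\<close> misses every other colour and \<open>[w, w']\<close> is a fan. A colour missing
  at \<open>w'\<close>, which exists as \<open>3 \<le> k\<close>, equals \<open>a\<close> or is also
  missing at \<open>w\<close>; either way the colouring extends.\<close>

lemma critical_degree_two:
  assumes crit: "critical E k" and k: "3 \<le> k"
    and w: "{u, w} \<in> E" "deg E w \<le> 2" and w': "{u, w'} \<in> E" "deg E w' \<le> 2"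
  shows "w = w'"
proof (rule ccontr)
  assume ne: "w \<noteq> w'"
  have E: "simple_edges E" and ncol: "\<not> edge_colourable E k" and fin: "finite E"
    using crit by (auto simp: critical_def simple_edges_def)
  define F where "F = E - {{u, w}}"
  obtain c where c: "edge_col F k c"
    using crit w by (auto simp: critical_def edge_colourable_def F_def)
  have EF: "insert {u, w} F = E" "{u, w} \<notin> F" and finF: "finite F"
    using w fin by (auto simp: F_def)
  have uw: "u \<noteq> w" "u \<noteq> w'" using E w w' by (auto simp: simple_edges_def)
  have e': "{u, w'} \<in> F" using w' ne by (auto simp: doubleton_eq_iff F_def)
  have sub: "star F w \<subset> star E w" "star F u \<subset> star E u" using w by (auto simp: star_def F_def)
  have "deg F w < deg E w" "deg F u < deg E u"
    using psubset_card_mono[OF _ sub(1)] psubset_card_mono[OF _ sub(2)] fin by auto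
  moreover have "deg E u \<le> k" using crit by (simp add: critical_def)
  ultimately have dw: "deg F w \<le> 1" and du: "deg F u < k" using w(2) by linarith+
  obtain a where a: "missing F k c u a" using exists_missing[OF finF du] by blast
  have "\<not> missing F k c w a" using edge_colourable_insert[OF c a, of w] EF ncol by auto
  then obtain f where f: "f \<in> star F w" "c f = a" using a by (auto simp: missing_def star_def)
  have mw: "missing F k c w i" if "i < k" "i \<noteq> a" for i
  proof -
    have "card (star F w) \<noteq> 0" using f finF by auto
    then have "card (star F w) = 1" using dw by simp
    then obtain g where g: "star F w = {g}" by (rule card_1_singletonE)
    have "e = f" if "e \<in> F" "w \<in> e" for e
    proof -
      have "e \<in> star F w" using that by (simp add: star_def)
      then show ?thesis using f(1) unfolding g by simp
    qed
    then show ?thesis using that f(2) unfolding missing_def by metis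
  qed
  have ca: "c {u, w'} \<noteq> a" "c {u, w'} < k"
    using a e' c by (auto simp: missing_def edge_col_def image_subset_iff)
  have "deg F w' < k"
  proof -
    have "deg F w' \<le> deg E w'" using fin by (intro card_mono) (auto simp: star_def F_def)
    then show ?thesis using w' k by simp
  qed
  then obtain b where b: "missing F k c w' b" using exists_missing[OF finF] by blast
  have fan: "fan F k c u [w, w']" using e' mw ca by auto
  have "b \<noteq> a" using fan_colourable[OF c fan, of a] ne uw a b EF ncol by auto
  then have "missing F k c w b" using mw b by (auto simp: missing_def)
  then have "edge_colourable (insert {u, w} F) k"
    using fan_disjoint_missing[OF _ c _ fan] E EF ne uw du b by auto
  then show False using EF ncol by simp
qed

subsection \<open>Edge cuts of critical graphs\<close>

definition edge_cut :: "'v set set \<Rightarrow> 'v set \<Rightarrow> 'v set set" where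
  "edge_cut E X = {e \<in> E. e \<inter> X \<noteq> {} \<and> \<not> e \<subseteq> X}"

lemma finite_edge_cut [simp]: "finite E \<Longrightarrow> finite (edge_cut E X)"
  by (simp add: edge_cut_def)

lemma edge_cut_Compl: "edge_cut E (- X) = edge_cut E X"
  by (auto simp: edge_cut_def)

text \<open>The inequality holds edge by edge, by cases on which of the two sets contain each
  end.\<close>

lemma edge_cut_submodular:
  assumes "simple_edges E"
  shows "card (edge_cut E (X \<inter> Y)) + card (edge_cut E (X \<union> Y)) \<le> card (edge_cut E X) + card (edge_cut E Y)"
proof -
  have fin: "finite E" using assms by (simp add: simple_edges_def)
  have card: "card (edge_cut E Z) = (\<Sum>e\<in>E. if e \<inter> Z \<noteq> {} \<and> \<not> e \<subseteq> Z then 1 else 0)" for Z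
    using fin by (simp add: edge_cut_def sum.If_cases Int_def)
  show ?thesis
    unfolding card sum.distrib[symmetric]
  proof (rule sum_mono)
    fix e assume "e \<in> E"
    then obtain u v where e: "e = {u, v}" using assms by (auto simp: simple_edges_def card_2_iff)
    show "(if e \<inter> (X \<inter> Y) \<noteq> {} \<and> \<not> e \<subseteq> X \<inter> Y then 1 else 0) +
      (if e \<inter> (X \<union> Y) \<noteq> {} \<and> \<not> e \<subseteq> X \<union> Y then 1 else 0)
      \<le> (if e \<inter> X \<noteq> {} \<and> \<not> e \<subseteq> X then 1 else 0) + (if e \<inter> Y \<noteq> {} \<and> \<not> e \<subseteq> Y then 1 else (0::nat))"
      unfolding e by (cases "u \<in> X"; cases "v \<in> X"; cases "u \<in> Y"; cases "v \<in> Y") auto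
  qed
qed

section \<open>Uncrossing minimum cuts\<close>

definition min_cut :: "'v set set \<Rightarrow> 'v \<Rightarrow> 'v \<Rightarrow> 'v set \<Rightarrow> bool" where
  "min_cut E x y X \<longleftrightarrow> x \<in> X \<and> y \<notin> X \<and>
     (\<forall>Y. x \<in> Y \<longrightarrow> y \<notin> Y \<longrightarrow> card (edge_cut E X) \<le> card (edge_cut E Y))"

lemma exists_min_cut: "x \<noteq> y \<Longrightarrow> \<exists>X. min_cut E x y X"
  using ex_has_least_nat[of "\<lambda>X. x \<in> X \<and> y \<notin> X" "{x}" "\<lambda>X. card (edge_cut E X)"]
  by (auto simp: min_cut_def)

lemma min_cut_Compl:
  assumes "min_cut E x y X"
  shows "min_cut E y x (- X)"
  unfolding min_cut_def edge_cut_Compl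
proof (intro conjI allI impI)
  fix Y assume "y \<in> Y" "x \<notin> Y"
  then show "card (edge_cut E X) \<le> card (edge_cut E Y)"
    using assms edge_cut_Compl[of E Y] unfolding min_cut_def by (metis ComplI ComplD)
qed (use assms in \<open>auto simp: min_cut_def\<close>)

text \<open>The union \<open>X \<union> Y\<close> still separates \<open>x\<close> from
  \<open>z\<close>, so its cut is at least that of \<open>X\<close>; submodularity then bounds the
  cut of \<open>X \<inter> Y\<close> by that of \<open>Y\<close>.\<close>

lemma min_cut_restrict:
  assumes E: "simple_edges E" and X: "min_cut E x z X" and Y: "min_cut E p q Y"
    and p: "p \<in> X" and z: "z \<notin> Y"
  shows "min_cut E p q (X \<inter> Y)"
proof -
  have "card (edge_cut E X) \<le> card (edge_cut E (X \<union> Y))"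
    using X z by (auto simp: min_cut_def)
  then have "card (edge_cut E (X \<inter> Y)) \<le> card (edge_cut E Y)"
    using edge_cut_submodular[OF E, of X Y] by linarith
  then show ?thesis using Y p unfolding min_cut_def by (meson IntD2 IntI le_trans)
qed

text \<open>An inclusion-minimal minimum cut between two elements of \<open>S\<close> has a single element of \<open>S\<close>
  on one side, since a cut separating two such elements could be uncrossed with it.\<close>

lemma isolating_min_cut:
  assumes E: "simple_edges E" and V: "finite V" "\<Union>E \<subseteq> V" "S \<subseteq> V"
    and S: "x0 \<in> S" "y0 \<in> S" "x0 \<noteq> y0"
  shows "\<exists>x\<in>S. \<exists>z\<in>S. \<exists>X\<subseteq>V. x \<noteq> z \<and> min_cut E x z X \<and> X \<inter> S = {x}"
proof -
  let ?P = "\<lambda>X. X \<subseteq> V \<and> (\<exists>x\<in>S. \<exists>z\<in>S. x \<noteq> z \<and> min_cut E x z X)"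
  \<comment> \<open>Intersecting with \<open>V\<close> does not change the cut and makes the set
    finite, so that a smallest one can be chosen.\<close>
  have cutV: "edge_cut E (X \<inter> V) = edge_cut E X" for X using V by (auto simp: edge_cut_def)
  have minV: "min_cut E x z (X \<inter> V)" if "min_cut E x z X" "x \<in> S" for x z X
    using that V by (auto simp: min_cut_def cutV)
  obtain X0 where "min_cut E x0 y0 X0" using exists_min_cut S by metis
  then have "?P (X0 \<inter> V)" using minV S by blast
  then obtain X where "?P X" and least: "\<And>Y. ?P Y \<Longrightarrow> card X \<le> card Y"
    using ex_has_least_nat[of ?P _ card] by metis
  then obtain x z where X: "X \<subseteq> V" "x \<in> S" "z \<in> S" "x \<noteq> z" "min_cut E x z X" by blast
  have "y = x" if y: "y \<in> X" "y \<in> S" for y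
  proof (rule ccontr)
    assume "y \<noteq> x"
    then obtain Y0 where Y0: "min_cut E x y Y0" using exists_min_cut by metis
    have x: "x \<in> X" using X by (simp add: min_cut_def)
    \<comment> \<open>If \<open>z\<close> lies in \<open>Y0\<close>, the complement is taken and
      \<open>x\<close> and \<open>y\<close> change roles, so that \<open>z\<close> is outside
      \<open>Y\<close> in either case.\<close>
    obtain p q Y where Y: "{p, q} = {x, y}" "min_cut E p q Y" "z \<notin> Y"
    proof (cases "z \<in> Y0")
      case True
      then show ?thesis using that[of y x "- Y0"] min_cut_Compl[OF Y0] by auto
    next
      case False
      then show ?thesis using that[of x y Y0] Y0 by auto
    qed
    then have pq: "p \<in> X" "q \<in> X" "p \<in> S" "q \<in> S" "p \<noteq> q"
      using x y X(2) \<open>y \<noteq> x\<close> by (auto simp: doubleton_eq_iff)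
    have XY: "min_cut E p q (X \<inter> Y)" using min_cut_restrict[OF E X(5) Y(2)] pq Y by blast
    then have "X \<inter> Y \<subset> X" using pq by (auto simp: min_cut_def)
    then have "card (X \<inter> Y) < card X"
      using X(1) V(1) by (meson finite_subset psubset_card_mono)
    moreover have "?P (X \<inter> Y)" using XY pq X(1) by blast
    ultimately show False using least by (metis linorder_not_less)
  qed
  then have "X \<inter> S = {x}" using X by (auto simp: min_cut_def)
  then show ?thesis using X by blast
qed

text \<open>Otherwise \<open>isolating_min_cut\<close> yields a cut with fewer than \<open>k\<close>
  edges around a set \<open>X\<close> whose only vertex of degree \<open>k\<close> is
  \<open>x\<close>. But the \<open>k\<close> edges at \<open>x\<close> inject into this cut: an edge
  that leaves \<open>X\<close> goes to itself, an edge \<open>{x, u}\<close> inside \<open>X\<close>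
  to an edge from \<open>u\<close> to another vertex of degree \<open>k\<close>, which lies outside
  \<open>X\<close>.\<close>

theorem critical_connected_pair:
  assumes crit: "critical E k"
  shows "\<exists>x y. x \<noteq> y \<and> deg E x = k \<and> deg E y = k \<and>
    (\<forall>X. x \<in> X \<longrightarrow> y \<notin> X \<longrightarrow> k \<le> card (edge_cut E X))"
proof (rule ccontr)
  assume neg: "\<not> ?thesis"
  have E: "simple_edges E" and fin: "finite E" using crit by (auto simp: critical_def simple_edges_def)
  obtain u w where uw: "{u, w} \<in> E" using critical_edge[OF crit] .
  define V where "V = \<Union>E"
  have finV: "finite V" using E unfolding V_def simple_edges_def by (metis card.infinite finite_Union zero_neq_numeral)
  define S where "S = {v \<in> V. deg E v = k}"
  have inS: "v \<in> S" if "deg E v = k" "{u, v} \<in> E" for u v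
    using that by (auto simp: S_def V_def)
  obtain x0 where x0: "{u, x0} \<in> E" "deg E x0 = k" using critical_neighbour[OF crit uw] by blast
  obtain y0 where y0: "{u, y0} \<in> E" "deg E y0 = k" "y0 \<noteq> x0"
    using critical_neighbour[OF crit x0(1)] by blast
  have "S \<subseteq> V" by (auto simp: S_def)
  then obtain x z X where x: "x \<in> S" "z \<in> S" "x \<noteq> z" "min_cut E x z X" "X \<inter> S = {x}"
    using isolating_min_cut[OF E finV, of S x0 y0] inS x0 y0 V_def by blast
  then have xd: "deg E x = k" "deg E z = k" by (auto simp: S_def)
  then obtain Y where "x \<in> Y" "z \<notin> Y" "card (edge_cut E Y) < k" using neg x(3) by (metis linorder_not_less)
  then have small: "card (edge_cut E X) < k" using x(4) unfolding min_cut_def by (meson le_less_trans)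
  have xX: "x \<in> X" using x(5) by blast
  \<comment> \<open>For an inner edge the trace \<open>g \<inter> X = e - {x}\<close> recovers
    \<open>e\<close>, which gives injectivity.\<close>
  have "\<exists>g\<in>edge_cut E X. (\<not> e \<subseteq> X \<longrightarrow> g = e) \<and> (e \<subseteq> X \<longrightarrow> g \<inter> X = e - {x})"
    if e: "e \<in> star E x" for e
  proof (cases "e \<subseteq> X")
    case True
    obtain u where u: "u \<noteq> x" "e = {x, u}"
      using simple_edges_doubleton[OF E, of e x] e by (auto simp: star_def)
    then have "{u, x} \<in> E" using e by (simp add: star_def insert_commute)
    then obtain s where s: "s \<noteq> x" "{u, s} \<in> E" "deg E s = k"
      using critical_neighbour[OF crit] by blast
    then have "s \<notin> X" using inS x(5) by blast
    then show ?thesis using u s True by (intro bexI[of _ "{u, s}"]) (auto simp: edge_cut_def)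
  next
    case False
    then show ?thesis using e xX by (intro bexI[of _ e]) (auto simp: edge_cut_def star_def)
  qed
  then obtain g where g: "\<And>e. e \<in> star E x \<Longrightarrow> g e \<in> edge_cut E X"
    "\<And>e. e \<in> star E x \<Longrightarrow> \<not> e \<subseteq> X \<Longrightarrow> g e = e"
    "\<And>e. e \<in> star E x \<Longrightarrow> e \<subseteq> X \<Longrightarrow> g e \<inter> X = e - {x}" by metis
  have "inj_on g (star E x)"
  proof (rule inj_onI)
    fix e f assume ef: "e \<in> star E x" "f \<in> star E x" "g e = g f"
    have xe: "x \<in> e" "x \<in> f" using ef by (auto simp: star_def)
    \<comment> \<open>An edge that leaves \<open>X\<close> contains \<open>x\<close>, whereas the
      substitute of an inner edge does not.\<close>
    have mixed: False if "e \<in> star E x" "f \<in> star E x" "g e = g f" "e \<subseteq> X" "\<not> f \<subseteq> X" for e f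
    proof -
      have "x \<in> g e \<inter> X" using g(2)[OF that(2,5)] that(2,3) xX by (simp add: star_def)
      then show False using g(3)[OF that(1,4)] by simp
    qed
    show "e = f"
    proof (cases "e \<subseteq> X")
      case True
      then have "f \<subseteq> X" using mixed ef by blast
      then have "e - {x} = f - {x}" using g(3)[OF ef(1) True] g(3)[OF ef(2)] ef(3) by simp
      then show ?thesis using xe by blast
    next
      case False
      then have "\<not> f \<subseteq> X" using mixed[of f e] ef by metis
      then show ?thesis using g(2) ef False by metis
    qed
  qed
  then have "deg E x \<le> card (edge_cut E X)"
    using card_inj_on_le[of g "star E x" "edge_cut E X"] g(1) finite_edge_cut[OF fin] by blast
  then show False using small xd by simp
qed

subsection \<open>Menger's theorem\<close>

text \<open>Menger's theorem is proved for directed graphs, given as relations, since its induction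
  removes one ordered pair at a time.\<close>

definition walk :: "('a \<times> 'a) set \<Rightarrow> 'a list \<Rightarrow> bool" where
  "walk R p \<longleftrightarrow> p \<noteq> [] \<and> successively (\<lambda>a b. (a, b) \<in> R) p"

lemma walk_singleton [simp]: "walk R [a]"
  by (simp add: walk_def)

lemma walk_Cons: "p \<noteq> [] \<Longrightarrow> walk R (a # p) \<longleftrightarrow> (a, hd p) \<in> R \<and> walk R p"
  by (cases p) (auto simp: walk_def)

lemma walk_append:
  "p \<noteq> [] \<Longrightarrow> q \<noteq> [] \<Longrightarrow> walk R (p @ q) \<longleftrightarrow> walk R p \<and> walk R q \<and> (last p, hd q) \<in> R"
  by (auto simp: walk_def successively_append_iff)

lemma walk_mono: "walk R p \<Longrightarrow> R \<subseteq> R' \<Longrightarrow> walk R' p"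
  unfolding walk_def by (metis (no_types, lifting) subsetD successively_mono)

lemma walk_join:
  assumes "walk R (xs @ [v])" "walk R (v # ys)"
  shows "walk R (xs @ v # ys)"
proof (cases "xs = []")
  case False
  then show ?thesis using assms by (simp add: walk_append)
qed (use assms in simp)

lemma walk_split:
  assumes "walk R (xs @ v # ys)"
  shows "walk R (xs @ [v])" "walk R (v # ys)"
  using assms by (cases "xs = []"; cases "ys = []"; auto simp: walk_append walk_Cons)+

lemma walk_set: "walk R p \<Longrightarrow> R \<subseteq> V \<times> V \<Longrightarrow> hd p \<in> V \<Longrightarrow> set p \<subseteq> V"
proof (induction p)
  case (Cons a p)
  then show ?case by (cases "p = []") (auto simp: walk_Cons)
qed simp

text \<open>Cut out the closed part between two occurrences of a vertex and repeat.\<close>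

lemma walk_distinct:
  assumes "walk R p"
  shows "\<exists>q. walk R q \<and> distinct q \<and> hd q = hd p \<and> last q = last p \<and> set q \<subseteq> set p"
  using assms
proof (induction "length p" arbitrary: p rule: less_induct)
  case less
  show ?case
  proof (cases "distinct p")
    case False
    then obtain xs ys zs v where p: "p = xs @ [v] @ ys @ [v] @ zs"
      using not_distinct_decomp by blast
    have "walk R (xs @ [v])" "walk R (v # zs)"
      using less.prems walk_split[of R xs v "ys @ v # zs"] walk_split[of R "v # ys" v zs]
        walk_split[of R "xs @ v # ys" v zs] by (auto simp: p)
    then have "walk R (xs @ v # zs)" by (rule walk_join)
    moreover have "length (xs @ v # zs) < length p" by (simp add: p)
    ultimately obtain q where "walk R q" "distinct q" "hd q = hd (xs @ v # zs)"
      "last q = last (xs @ v # zs)" "set q \<subseteq> set (xs @ v # zs)"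
      using less.hyps[of "xs @ v # zs"] by blast
    then show ?thesis by (intro exI[of _ q]) (auto simp: p hd_append)
  qed (use less.prems in auto)
qed

lemma walk_remove_pair:
  assumes "walk R p" "\<not> walk (R - {(x, y)}) p"
  shows "\<exists>xs ys. p = xs @ x # y # ys"
  using assms
proof (induction p)
  case (Cons a p)
  show ?case
  proof (cases "p = []")
    case False
    then obtain b q where p: "p = b # q" by (cases p) auto
    then consider "(a, b) = (x, y)" | "\<not> walk (R - {(x, y)}) p"
      using Cons.prems by (auto simp: walk_Cons)
    then show ?thesis
    proof cases
      case 1
      then show ?thesis using p by (metis append_Nil prod.inject)
    next
      case 2
      then obtain xs ys where "p = xs @ x # y # ys" using Cons False by (auto simp: walk_Cons)
      then have "a # p = (a # xs) @ x # y # ys" by simp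
      then show ?thesis by blast
    qed
  qed (use Cons in simp)
qed (simp add: walk_def)

text \<open>Walks with a single vertex count, so every separator contains
  \<open>A \<inter> B\<close>.\<close>

definition separator :: "('a \<times> 'a) set \<Rightarrow> 'a set \<Rightarrow> 'a set \<Rightarrow> 'a set \<Rightarrow> bool" where
  "separator R A B S \<longleftrightarrow>
     (\<forall>p. walk R p \<longrightarrow> hd p \<in> A \<longrightarrow> last p \<in> B \<longrightarrow> set p \<inter> S \<noteq> {})"

definition disjoint_paths :: "('a \<times> 'a) set \<Rightarrow> 'a set \<Rightarrow> 'a set \<Rightarrow> 'a list set \<Rightarrow> bool" where
  "disjoint_paths R A B \<P> \<longleftrightarrow>
     (\<forall>p\<in>\<P>. walk R p \<and> distinct p \<and> hd p \<in> A \<and> last p \<in> B) \<and>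
     (\<forall>p\<in>\<P>. \<forall>q\<in>\<P>. set p \<inter> set q \<noteq> {} \<longrightarrow> p = q)"

lemma walk_hd_in [simp]: "walk R p \<Longrightarrow> hd p \<in> set p" and walk_last_in [simp]: "walk R p \<Longrightarrow> last p \<in> set p"
  by (auto simp: walk_def)

text \<open>Disjointness makes \<open>last\<close> injective. With as many paths as elements of
  \<open>B\<close>, every element of \<open>B\<close> ends a path, and no other path can pass
  through it.\<close>

lemma disjoint_paths_last:
  assumes "disjoint_paths R A B \<P>" "finite B" "card \<P> = card B"
  shows "bij_betw last \<P> B" "\<And>p. p \<in> \<P> \<Longrightarrow> set p \<inter> B = {last p}"
proof -
  have inj: "inj_on last \<P>"
    using assms(1) unfolding disjoint_paths_def inj_on_def by (metis IntI empty_iff walk_last_in)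
  have sub: "last ` \<P> \<subseteq> B" using assms(1) by (auto simp: disjoint_paths_def)
  have "card (last ` \<P>) = card B" using card_image[OF inj] assms(3) by simp
  then have im: "last ` \<P> = B" using card_subset_eq[OF assms(2) sub] by simp
  then show "bij_betw last \<P> B" using inj by (simp add: bij_betw_def)
  fix p assume p: "p \<in> \<P>"
  have "b = last p" if b: "b \<in> set p" "b \<in> B" for b
  proof -
    obtain q where q: "q \<in> \<P>" "b = last q" using b im by blast
    then have "b \<in> set q" using assms(1) by (auto simp: disjoint_paths_def)
    then show ?thesis using b p q assms(1) unfolding disjoint_paths_def by blast
  qed
  then show "set p \<inter> B = {last p}" using p sub assms(1) by (auto simp: disjoint_paths_def)
qed

lemma disjoint_paths_hd:
  assumes "disjoint_paths R A B \<P>" "finite A" "card \<P> = card A"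
  shows "bij_betw hd \<P> A" "\<And>p. p \<in> \<P> \<Longrightarrow> set p \<inter> A = {hd p}"
proof -
  have inj: "inj_on hd \<P>"
    using assms(1) unfolding disjoint_paths_def inj_on_def by (metis IntI empty_iff walk_hd_in)
  have sub: "hd ` \<P> \<subseteq> A" using assms(1) by (auto simp: disjoint_paths_def)
  have "card (hd ` \<P>) = card A" using card_image[OF inj] assms(3) by simp
  then have im: "hd ` \<P> = A" using card_subset_eq[OF assms(2) sub] by simp
  then show "bij_betw hd \<P> A" using inj by (simp add: bij_betw_def)
  fix p assume p: "p \<in> \<P>"
  have "b = hd p" if b: "b \<in> set p" "b \<in> A" for b
  proof -
    obtain q where q: "q \<in> \<P>" "b = hd q" using b im by blast
    then have "b \<in> set q" using assms(1) by (auto simp: disjoint_paths_def)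
    then show ?thesis using b p q assms(1) unfolding disjoint_paths_def by blast
  qed
  then show "set p \<inter> A = {hd p}" using p sub assms(1) by (auto simp: disjoint_paths_def)
qed

text \<open>Stop a walk from \<open>A\<close> to \<open>B\<close> at its first vertex in
  \<open>P\<close>. This part does not use \<open>(x, y)\<close>, since \<open>x\<close> is in
  \<open>P\<close> and would have stopped it earlier; so it meets \<open>F\<close>.\<close>

lemma separator_prefix:
  assumes sep: "separator R A B P" and x: "x \<in> P" and F: "separator (R - {(x, y)}) A P F"
  shows "separator R A B F"
  unfolding separator_def
proof (intro allI impI)
  fix p assume p: "walk R p" "hd p \<in> A" "last p \<in> B"
  then have "\<exists>v\<in>set p. v \<in> P" using sep by (auto simp: separator_def)
  then obtain xs v ys where v: "p = xs @ v # ys" "v \<in> P" "\<forall>u\<in>set xs. u \<notin> P"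
    using split_list_first_propE[of p "\<lambda>v. v \<in> P"] by metis
  have "walk R (xs @ [v])" using walk_split p v by metis
  moreover have "\<nexists>us vs. xs @ [v] = us @ x # y # vs"
  proof
    assume "\<exists>us vs. xs @ [v] = us @ x # y # vs"
    then obtain us vs where "xs @ [v] = us @ x # y # vs" by blast
    then have "butlast (xs @ [v]) = us @ x # butlast (y # vs)" by (simp add: butlast_append)
    then have "x \<in> set xs" by simp
    then show False using x v by auto
  qed
  ultimately have "walk (R - {(x, y)}) (xs @ [v])" using walk_remove_pair by metis
  moreover have "hd (xs @ [v]) \<in> A" using p v by (cases xs) auto
  ultimately have "set (xs @ [v]) \<inter> F \<noteq> {}"
    using F v unfolding separator_def by (metis last_snoc)
  then show "set p \<inter> F \<noteq> {}" using v by auto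
qed

text \<open>Mirror image of \<open>separator_prefix\<close>: the part of the walk from its last
  vertex in \<open>Q\<close> on cannot enter \<open>y\<close> again.\<close>

lemma separator_suffix:
  assumes sep: "separator R A B Q" and y: "y \<in> Q" and F: "separator (R - {(x, y)}) Q B F"
  shows "separator R A B F"
  unfolding separator_def
proof (intro allI impI)
  fix p assume p: "walk R p" "hd p \<in> A" "last p \<in> B"
  then have "\<exists>v\<in>set p. v \<in> Q" using sep by (auto simp: separator_def)
  then obtain xs v ys where v: "p = xs @ v # ys" "v \<in> Q" "\<forall>u\<in>set ys. u \<notin> Q"
    using split_list_last_propE[of p "\<lambda>v. v \<in> Q"] by metis
  have "walk R (v # ys)" using walk_split p v by metis
  moreover have "\<nexists>us vs. v # ys = us @ x # y # vs"
  proof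
    assume "\<exists>us vs. v # ys = us @ x # y # vs"
    then obtain us vs where "v # ys = us @ x # y # vs" by blast
    then have "ys = tl (us @ [x]) @ y # vs" by (cases us) auto
    then show False using y v by auto
  qed
  ultimately have "walk (R - {(x, y)}) (v # ys)" using walk_remove_pair by metis
  moreover have "last (v # ys) \<in> B" using p v by simp
  ultimately have "set (v # ys) \<inter> F \<noteq> {}"
    using F v unfolding separator_def by (metis list.sel(1))
  then show "set p \<inter> F \<noteq> {}" using v by auto
qed

text \<open>Following \<open>p\<close> up to \<open>v\<close> and then \<open>q\<close> gives a walk
  from \<open>A\<close> to \<open>B\<close>, which meets \<open>S\<close>. Since \<open>p\<close>
  meets \<open>S\<close> at most at its end and \<open>q\<close> at most at its start, this happens
  at \<open>v\<close>.\<close>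

lemma disjoint_paths_cross:
  assumes sep: "separator R A B S" and "S \<subseteq> P" "S \<subseteq> Q"
    and p: "walk R p" "distinct p" "hd p \<in> A" "set p \<inter> P = {last p}"
    and q: "walk R q" "distinct q" "last q \<in> B" "set q \<inter> Q = {hd q}"
    and v: "v \<in> set p" "v \<in> set q"
  shows "v \<in> S" "v = last p" "v = hd q"
proof -
  obtain xs xs' where xs: "p = xs @ v # xs'" using v by (meson split_list)
  obtain ys ys' where ys: "q = ys @ v # ys'" using v by (meson split_list)
  have "walk R (xs @ v # ys')"
    using walk_join walk_split p q xs ys by metis
  moreover have "hd (xs @ v # ys') \<in> A" using p xs by (cases xs) auto
  moreover have "last (xs @ v # ys') \<in> B" using q ys by auto
  ultimately obtain s where s: "s \<in> S" "s \<in> set (xs @ v # ys')"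
    using sep unfolding separator_def by blast
  have *: "s = v"
  proof (rule ccontr)
    assume "s \<noteq> v"
    then consider "s \<in> set xs" | "s \<in> set ys'" using s by auto
    then show False
    proof cases
      case 1
      then have "s = last p" using p s assms(2) xs by auto
      then have "s = last (v # xs')" using xs by simp
      then show ?thesis using 1 p xs by (metis disjoint_iff distinct_append last_in_set list.distinct(1))
    next
      case 2
      then have "s = hd q" using q s assms(3) ys by auto
      then show ?thesis using 2 q ys by (cases ys) auto
    qed
  qed
  then show "v \<in> S" using s by simp
  then show "v = last p" "v = hd q" using p q v assms(2,3) by auto
qed

text \<open>The proof is Goering's: if removing the pair \<open>(x, y)\<close> creates a smaller separator \<open>S\<close>, then
  both \<open>insert x S\<close> and \<open>insert y S\<close> are minimum separators, and the paths from \<open>A\<close> to the former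
  can be glued to the paths from the latter to \<open>B\<close>.\<close>

theorem Menger:
  assumes "finite R" "finite A" "finite B"
    and "\<And>S. finite S \<Longrightarrow> separator R A B S \<Longrightarrow> k \<le> card S"
  shows "\<exists>\<P>. finite \<P> \<and> card \<P> = k \<and> disjoint_paths R A B \<P>"
  using assms
proof (induction R arbitrary: A B k rule: finite_induct)
  case empty
  have "separator {} A B (A \<inter> B)"
    unfolding separator_def
  proof (intro allI impI)
    fix p :: "'a list" assume p: "walk {} p" "hd p \<in> A" "last p \<in> B"
    then obtain a where "p = [a]" by (cases p rule: remdups_adj.cases) (auto simp: walk_def)
    then show "set p \<inter> (A \<inter> B) \<noteq> {}" using p by auto
  qed
  then have "k \<le> card (A \<inter> B)" using empty by auto
  then obtain C where C: "C \<subseteq> A \<inter> B" "card C = k" by (meson obtain_subset_with_card_n)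
  have "finite C" using C empty finite_subset by blast
  then show ?case using C
    by (intro exI[of _ "(\<lambda>a. [a]) ` C"]) (auto simp: disjoint_paths_def card_image inj_on_def)
next
  case (insert e R)
  obtain x y where e: "e = (x, y)" by fastforce
  have R: "insert e R - {(x, y)} = R" using insert.hyps e by auto
  show ?case
  proof (cases "\<exists>S. finite S \<and> separator R A B S \<and> card S < k")
    case False
    then obtain \<P> where "finite \<P>" "card \<P> = k" "disjoint_paths R A B \<P>"
      using insert.IH[of A B k] insert.prems by (meson linorder_not_less)
    then show ?thesis
      using walk_mono[of R _ "insert e R"] by (intro exI[of _ \<P>]) (auto simp: disjoint_paths_def)
  next
    case True
    then obtain S where S: "finite S" "separator R A B S" "card S < k" by blast
    have sep: "separator (insert e R) A B (insert z S)" if "z \<in> {x, y}" for z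
      unfolding separator_def
    proof (intro allI impI)
      fix p assume p: "walk (insert e R) p" "hd p \<in> A" "last p \<in> B"
      show "set p \<inter> insert z S \<noteq> {}"
      proof (cases "walk R p")
        case False
        then obtain us vs where "p = us @ x # y # vs"
          using walk_remove_pair[OF p(1)] R by metis
        then show ?thesis using that by auto
      qed (use p S in \<open>auto simp: separator_def\<close>)
    qed
    let ?P = "insert x S" and ?Q = "insert y S"
    have "k \<le> card (insert z S)" if "z \<in> {x, y}" for z
      using insert.prems(3)[OF _ sep[OF that]] S by simp
    \<comment> \<open>As \<open>S\<close> has fewer than \<open>k\<close> elements, adding
      \<open>z\<close> must raise its size to exactly \<open>k\<close>.\<close>
    then have k: "card (insert z S) = k" and zS: "z \<notin> S" if "z \<in> {x, y}" for z
      using S that by (metis card_insert_if le_antisym not_le Suc_leI)+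
    have "k \<le> card F" if "finite F" "separator R A ?P F" for F
      using insert.prems(3)[OF that(1)] separator_prefix[of "insert e R" A B ?P x y F] sep R that by auto
    then obtain \<P> where P: "finite \<P>" "card \<P> = k" "disjoint_paths R A ?P \<P>"
      using insert.IH[of A ?P k] insert.prems S by blast
    have "k \<le> card F" if "finite F" "separator R ?Q B F" for F
      using insert.prems(3)[OF that(1)] separator_suffix[of "insert e R" A B ?Q y x F] sep R that by auto
    then obtain \<Q> where Q: "finite \<Q>" "card \<Q> = k" "disjoint_paths R ?Q B \<Q>"
      using insert.IH[of ?Q B k] insert.prems S by blast
    note Pl = disjoint_paths_last[OF P(3)]
    note Qh = disjoint_paths_hd[OF Q(3)]
    have Pb: "bij_betw last \<P> ?P" and Pi: "\<And>p. p \<in> \<P> \<Longrightarrow> set p \<inter> ?P = {last p}"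
      using Pl S P k by auto
    have Qb: "bij_betw hd \<Q> ?Q" and Qi: "\<And>p. p \<in> \<Q> \<Longrightarrow> set p \<inter> ?Q = {hd p}"
      using Qh S Q k by auto
    \<comment> \<open>\<open>f z\<close> is the path from \<open>A\<close> that ends at
      \<open>z\<close>, and \<open>g z\<close> the path to \<open>B\<close> that starts at
      \<open>z\<close>.\<close>
    define f where "f = inv_into \<P> last"
    define g where "g = inv_into \<Q> hd"
    have f: "f z \<in> \<P>" "last (f z) = z" if "z \<in> ?P" for z
      using that Pb unfolding f_def bij_betw_def
      by (auto simp: inv_into_into f_inv_into_f simp del: insert_iff)
    have g: "g z \<in> \<Q>" "hd (g z) = z" if "z \<in> ?Q" for z
      using that Qb unfolding g_def bij_betw_def
      by (auto simp: inv_into_into f_inv_into_f simp del: insert_iff)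
    have fw: "walk R (f z)" "distinct (f z)" "hd (f z) \<in> A" if "z \<in> ?P" for z
      using f[OF that] P(3) by (auto simp: disjoint_paths_def)
    have gw: "walk R (g z)" "distinct (g z)" "last (g z) \<in> B" if "z \<in> ?Q" for z
      using g[OF that] Q(3) by (auto simp: disjoint_paths_def)
    have ff: "z = z'" if "z \<in> ?P" "z' \<in> ?P" "v \<in> set (f z)" "v \<in> set (f z')" for z z' v
      using f that P(3) unfolding disjoint_paths_def by (metis IntI empty_iff)
    have gg: "z = z'" if "z \<in> ?Q" "z' \<in> ?Q" "v \<in> set (g z)" "v \<in> set (g z')" for z z' v
      using g that Q(3) unfolding disjoint_paths_def by (metis IntI empty_iff)
    have fg: "v \<in> S \<and> v = z \<and> v = z'"
      if "z \<in> ?P" "z' \<in> ?Q" "v \<in> set (f z)" "v \<in> set (g z')" for z z' v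
      using disjoint_paths_cross[OF S(2) subset_insertI[of S x] subset_insertI[of S y],
          of "f z" "g z'" v] f g fw gw Pi Qi that by metis
    \<comment> \<open>The new pair \<open>(x, y)\<close> joins the path ending at \<open>x\<close>
      to the one starting at \<open>y\<close>; all others are joined at their common vertex in
      \<open>S\<close>, which \<open>tl\<close> keeps from being repeated.\<close>
    define t where "t z = (if z = x then y else z)" for z
    define h where "h z = (if z = x then f x @ g y else f z @ tl (g z))" for z
    have tQ: "t z \<in> ?Q" if "z \<in> ?P" for z using that by (auto simp: t_def)
    have t_inj: "z = z'" if "z \<in> ?P" "z' \<in> ?P" "t z = t z'" for z z'
      using that zS by (auto simp: t_def split: if_splits)
    have hset: "set (h z) = set (f z) \<union> set (g (t z))" if "z \<in> ?P" for z
    proof (cases "z = x")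
      case False
      then have z: "z \<in> ?Q" "z \<in> S" using that by auto
      obtain ys where "g z = z # ys" using g[OF z(1)] gw[OF z(1)] by (metis list.collapse walk_def)
      moreover have "z \<in> set (f z)" using f[OF that] fw[OF that] by (metis walk_last_in)
      ultimately show ?thesis using False by (auto simp: h_def t_def)
    qed (simp add: h_def t_def)
    have h: "walk (insert e R) (h z) \<and> distinct (h z) \<and> hd (h z) \<in> A \<and> last (h z) \<in> B"
      if z: "z \<in> ?P" for z
    proof (cases "z = x")
      case True
      have ne: "f x \<noteq> []" "g y \<noteq> []" using fw[of x] gw[of y] by (auto simp: walk_def)
      have "walk (insert e R) (f x)" "walk (insert e R) (g y)"
        using fw(1)[of x] gw(1)[of y] walk_mono[of R _ "insert e R"] by blast+
      then have "walk (insert e R) (f x @ g y)"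
        using f(2)[of x] g(2)[of y] e unfolding walk_append[OF ne] by simp
      moreover have "set (f x) \<inter> set (g y) = {}"
        using fg[of x y] zS[of x] by blast
      then have "distinct (f x @ g y)" using fw(2)[of x] gw(2)[of y] by simp
      ultimately show ?thesis using True ne fw(3)[of x] gw(3)[of y] by (simp add: h_def)
    next
      case False
      then have zQ: "z \<in> ?Q" using z by auto
      obtain ys where ys: "g z = z # ys" using g[OF zQ] gw[OF zQ] by (metis list.collapse walk_def)
      obtain xs where xs: "f z = xs @ [z]"
        using f[OF z] fw[OF z] by (metis append_butlast_last_id walk_def)
      have "walk R (xs @ z # ys)" using walk_join fw[OF z] gw[OF zQ] xs ys by metis
      moreover have "distinct (xs @ z # ys)"
      proof -
        have "v = z" if "v \<in> set xs" "v \<in> set ys" for v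
          using fg[OF z zQ, of v] that by (auto simp: xs ys)
        then show ?thesis using fw[OF z] gw[OF zQ] by (auto simp: xs ys)
      qed
      moreover have "hd (xs @ z # ys) \<in> A" using fw[OF z] xs by (cases xs) auto
      moreover have "last (xs @ z # ys) \<in> B" using gw[OF zQ] ys by auto
      moreover have "h z = xs @ z # ys" using False by (simp add: h_def xs ys)
      ultimately show ?thesis using walk_mono[of R _ "insert e R"] by auto
    qed
    have hd: "z = z'" if z: "z \<in> ?P" "z' \<in> ?P" "set (h z) \<inter> set (h z') \<noteq> {}" for z z'
    proof -
      obtain v where v: "v \<in> set (h z)" "v \<in> set (h z')" using z by auto
      have *: "a = b" if "a \<in> ?P" "b \<in> ?P" "v \<in> set (f a)" "v \<in> set (g (t b))" for a b
        using fg[OF that(1) tQ[OF that(2)] that(3,4)] zS that by (auto simp: t_def split: if_splits)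
      consider "v \<in> set (f z)" "v \<in> set (f z')" | "v \<in> set (f z)" "v \<in> set (g (t z'))"
        | "v \<in> set (g (t z))" "v \<in> set (f z')" | "v \<in> set (g (t z))" "v \<in> set (g (t z'))"
        using v unfolding hset[OF z(1)] hset[OF z(2)] by blast
      then show ?thesis
      proof cases
        case 1
        then show ?thesis using ff z by blast
      next
        case 2
        then show ?thesis using * z by blast
      next
        case 3
        then show ?thesis using *[of z' z] z by auto
      next
        case 4
        then show ?thesis using gg[OF tQ[OF z(1)] tQ[OF z(2)]] t_inj[OF z(1,2)] by blast
      qed
    qed
    have "inj_on h ?P"
    proof (rule inj_onI)
      fix z z' assume z: "z \<in> ?P" "z' \<in> ?P" "h z = h z'"
      have "hd (h z) \<in> set (h z)" using h[OF z(1)] walk_hd_in by blast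
      then have "set (h z) \<inter> set (h z') \<noteq> {}" using z(3) by (metis IntI empty_iff)
      then show "z = z'" by (rule hd[OF z(1,2)])
    qed
    then have "card (h ` ?P) = k" using k[of x] by (simp only: card_image insert_iff simp_thms)
    moreover have "disjoint_paths (insert e R) A B (h ` ?P)"
      unfolding disjoint_paths_def
    proof (intro conjI ballI impI)
      fix p q assume "p \<in> h ` ?P" "q \<in> h ` ?P" "set p \<inter> set q \<noteq> {}"
      then obtain z z' where "z \<in> ?P" "z' \<in> ?P" "p = h z" "q = h z'" "set (h z) \<inter> set (h z') \<noteq> {}"
        by blast
      then show "p = q" using hd by blast
    next
      fix p assume "p \<in> h ` ?P"
      then obtain z where z: "z \<in> ?P" "p = h z" by (rule imageE)
      note hz = h[OF z(1), folded z(2)]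
      show "walk (insert e R) p" "distinct p" "hd p \<in> A" "last p \<in> B" using hz by simp_all
    qed
    moreover have "finite (h ` ?P)" using S by simp
    ultimately show ?thesis by (intro exI[of _ "h ` ?P"] conjI)
  qed
qed

subsection \<open>Odd cliques in line graphs of simple graphs\<close>

lemma path_edges_simps [simp]:
  "path_edges [] = {}" "path_edges [a] = {}"
  "path_edges (a # b # p) = insert {a, b} (path_edges (b # p))"
proof -
  show "path_edges (a # b # p) = insert {a, b} (path_edges (b # p))"
  proof (intro set_eqI iffI)
    fix g assume "g \<in> path_edges (a # b # p)"
    then obtain i where i: "g = {(a # b # p) ! i, (a # b # p) ! Suc i}" "Suc i < length (a # b # p)"
      by (auto simp: path_edges_def)
    then show "g \<in> insert {a, b} (path_edges (b # p))"
      by (cases i) (auto simp: path_edges_def)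
  next
    fix g assume "g \<in> insert {a, b} (path_edges (b # p))"
    then consider "g = {a, b}" | i where "g = {(b # p) ! i, (b # p) ! Suc i}" "Suc i < length (b # p)"
      by (auto simp: path_edges_def)
    then show "g \<in> path_edges (a # b # p)"
    proof cases
      case 1
      then show ?thesis unfolding path_edges_def by (intro CollectI exI[of _ 0]) auto
    next
      case 2
      then show ?thesis unfolding path_edges_def by (intro CollectI exI[of _ "Suc i"]) auto
    qed
  qed
qed (simp_all add: path_edges_def)

lemma path_edges_suffix: "path_edges q \<subseteq> path_edges (p @ q)"
proof (induction p)
  case (Cons a p)
  then show ?case by (cases "p @ q") auto
qed simp

lemma path_edges_snoc: "p \<noteq> [] \<Longrightarrow> path_edges (p @ [b]) = insert {last p, b} (path_edges p)"
proof (induction p)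
  case (Cons a p)
  then show ?case by (cases p) auto
qed simp

lemma path_edges_in_set: "g \<in> path_edges p \<Longrightarrow> g \<subseteq> set p"
  by (auto simp: path_edges_def)

lemma path_edges_card:
  assumes "g \<in> path_edges p" "distinct p"
  shows "card g = 2"
proof -
  obtain i where "g = {p ! i, p ! Suc i}" "Suc i < length p" using assms by (auto simp: path_edges_def)
  then show ?thesis using assms(2) by (simp add: nth_eq_iff_index_eq)
qed

lemma interior_distinct: "distinct p \<Longrightarrow> interior p = set p - {hd p, last p}"
proof (cases p)
  case (Cons a q)
  assume d: "distinct p"
  show ?thesis
  proof (cases q rule: rev_cases)
    case (snoc r b)
    then show ?thesis using d Cons by (auto simp: interior_def)
  qed (use Cons in \<open>simp add: interior_def\<close>)
qed (simp add: interior_def)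

text \<open>The paths are listed by their vertices, so an odd path is a list of even length.\<close>

definition odd_linking ::
  "('a \<times> 'a) set \<Rightarrow> nat \<Rightarrow> (nat \<Rightarrow> 'a) \<Rightarrow> (nat \<Rightarrow> nat \<Rightarrow> 'a list) \<Rightarrow> bool" where
  "odd_linking R t \<phi> Q \<longleftrightarrow>
     (\<forall>i j. i < j \<longrightarrow> j < t \<longrightarrow>
        walk R (Q i j) \<and> distinct (Q i j) \<and> hd (Q i j) = \<phi> i \<and> last (Q i j) = \<phi> j \<and>
        even (length (Q i j)) \<and> interior (Q i j) \<inter> \<phi> ` {..<t} = {}) \<and>
     (\<forall>i j i' j'. i < j \<longrightarrow> j < t \<longrightarrow> i' < j' \<longrightarrow> j' < t \<longrightarrow> (i, j) \<noteq> (i', j') \<longrightarrow>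
        path_edges (Q i j) \<inter> path_edges (Q i' j') = {})"

text \<open>A totally odd strong immersion of a complete graph with \<open>t\<close> terminals in
  \<open>V\<close>, one path for each pair \<open>i < j\<close>.\<close>

definition odd_clique :: "('a \<times> 'a) set \<Rightarrow> 'a set \<Rightarrow> nat \<Rightarrow> bool" where
  "odd_clique R V t \<longleftrightarrow>
     (\<exists>\<phi> Q. inj_on \<phi> {..<t} \<and> \<phi> ` {..<t} \<subseteq> V \<and> odd_linking R t \<phi> Q)"

lemma odd_linkingD:
  assumes "odd_linking R t \<phi> Q" "i < j" "j < t"
  shows "walk R (Q i j)" "distinct (Q i j)" "hd (Q i j) = \<phi> i" "last (Q i j) = \<phi> j"
    "even (length (Q i j))" "interior (Q i j) \<inter> \<phi> ` {..<t} = {}"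
  using assms by (simp_all add: odd_linking_def)

lemma odd_linking_disjoint:
  assumes "odd_linking R t \<phi> Q" "i < j" "j < t" "i' < j'" "j' < t" "(i, j) \<noteq> (i', j')"
  shows "path_edges (Q i j) \<inter> path_edges (Q i' j') = {}"
  using assms unfolding odd_linking_def by blast

lemma odd_clique_mono:
  assumes "odd_clique R V t" "R \<subseteq> R'" "V \<subseteq> V'" "s \<le> t"
  shows "odd_clique R' V' s"
proof -
  obtain \<phi> Q where 1: "inj_on \<phi> {..<t}" "\<phi> ` {..<t} \<subseteq> V" and Q: "odd_linking R t \<phi> Q"
    using assms(1) unfolding odd_clique_def by auto
  have s: "{..<s} \<subseteq> {..<t}" using assms(4) by auto
  have "odd_linking R' s \<phi> Q"
    unfolding odd_linking_def
  proof (rule conjI; intro allI impI)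
    fix i j assume "i < j" "j < s"
    then have "i < j" "j < t" using assms(4) by auto
    note ij = odd_linkingD[OF Q this]
    have "walk R' (Q i j)" using walk_mono[OF ij(1) assms(2)] .
    moreover have "interior (Q i j) \<inter> \<phi> ` {..<s} = {}" using ij(6) image_mono[OF s, of \<phi>] by (meson disjoint_iff subsetD)
    ultimately show "walk R' (Q i j) \<and> distinct (Q i j) \<and> hd (Q i j) = \<phi> i \<and> last (Q i j) = \<phi> j \<and>
        even (length (Q i j)) \<and> interior (Q i j) \<inter> \<phi> ` {..<s} = {}"
      using ij by simp
  next
    fix i j i' j' assume "i < j" "j < s" "i' < j'" "j' < s" "(i, j) \<noteq> (i', j')"
    then show "path_edges (Q i j) \<inter> path_edges (Q i' j') = {}"
      using odd_linking_disjoint[OF Q] assms(4) by simp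
  qed
  moreover have "inj_on \<phi> {..<s}" using 1 s inj_on_subset by blast
  moreover have "\<phi> ` {..<s} \<subseteq> V'" using 1(2) image_mono[OF s, of \<phi>] assms(3) by (meson order_trans)
  ultimately show ?thesis unfolding odd_clique_def by blast
qed

lemma odd_clique_clique:
  assumes T: "finite T" "T \<subseteq> V" and R: "\<And>a b. a \<in> T \<Longrightarrow> b \<in> T \<Longrightarrow> a \<noteq> b \<Longrightarrow> (a, b) \<in> R"
  shows "odd_clique R V (card T)"
proof -
  obtain \<phi> where \<phi>: "bij_betw \<phi> {..<card T} T"
    using ex_bij_betw_nat_finite[OF T(1)] by (auto simp: atLeast0LessThan)
  then have inj: "inj_on \<phi> {..<card T}" and im: "\<phi> ` {..<card T} = T" by (auto simp: bij_betw_def)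
  show ?thesis
    unfolding odd_clique_def odd_linking_def
  proof (intro exI[of _ \<phi>] exI[of _ "\<lambda>i j. [\<phi> i, \<phi> j]"] conjI allI impI)
    fix i j assume "i < j" "j < card T"
    then have ij: "i \<in> {..<card T}" "j \<in> {..<card T}" "i \<noteq> j" by auto
    then have n: "\<phi> i \<noteq> \<phi> j" using inj by (metis inj_onD)
    then show "walk R [\<phi> i, \<phi> j]" using R ij im by (auto simp: walk_Cons)
    show "distinct [\<phi> i, \<phi> j]" using n by simp
    show "interior [\<phi> i, \<phi> j] \<inter> \<phi> ` {..<card T} = {}" by (simp add: interior_def)
  next
    fix i j i' j' assume *: "i < j" "j < card T" "i' < j'" "j' < card T" "(i, j) \<noteq> (i', j')"
    then have "{i, j} \<noteq> {i', j'}" by (auto simp: doubleton_eq_iff)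
    then have "\<phi> ` {i, j} \<noteq> \<phi> ` {i', j'}"
      using inj_on_image_eq_iff[OF inj, of "{i, j}" "{i', j'}"] * by simp
    then show "path_edges [\<phi> i, \<phi> j] \<inter> path_edges [\<phi> i', \<phi> j'] = {}" by simp
  qed (use inj im T in auto)
qed

text \<open>Elements of \<open>T\<close> are joined directly. A path \<open>q a\<close> meets
  \<open>T\<close> only in \<open>a\<close>, so it contains no edge between two elements of
  \<open>T\<close>, and only the paths to \<open>f\<close> have to be compared with each
  other.\<close>

lemma odd_clique_extend:
  assumes T: "finite T" "T \<subseteq> V" and R: "\<And>a b. a \<in> T \<Longrightarrow> b \<in> T \<Longrightarrow> a \<noteq> b \<Longrightarrow> (a, b) \<in> R"
    and f: "f \<in> V" "f \<notin> T"
    and q: "\<And>a. a \<in> T \<Longrightarrow> walk R (q a) \<and> distinct (q a) \<and> hd (q a) = a \<and> last (q a) = f \<and>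
        even (length (q a)) \<and> set (q a) \<inter> T = {a}"
    and disj: "\<And>a b. a \<in> T \<Longrightarrow> b \<in> T \<Longrightarrow> a \<noteq> b \<Longrightarrow> path_edges (q a) \<inter> path_edges (q b) = {}"
  shows "odd_clique R V (Suc (card T))"
proof -
  define t where "t = card T"
  obtain \<phi>0 where \<phi>0: "bij_betw \<phi>0 {..<t} T"
    using ex_bij_betw_nat_finite[OF T(1)] by (auto simp: atLeast0LessThan t_def)
  \<comment> \<open>The new terminal \<open>f\<close> receives the last index
    \<open>t\<close>.\<close>
  define \<phi> where "\<phi> = \<phi>0(t := f)"
  have "bij_betw \<phi> {..<t} T"
    using bij_betw_cong[of "{..<t}" \<phi> \<phi>0 T] \<phi>0 by (simp add: \<phi>_def)
  then have inj0: "inj_on \<phi> {..<t}" and im0: "\<phi> ` {..<t} = T" by (auto simp: bij_betw_def)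
  have \<phi>t: "\<phi> t = f" by (simp add: \<phi>_def)
  have inT: "\<phi> i \<in> T" if "i < t" for i using im0 that by auto
  have im: "\<phi> ` {..<Suc t} = insert f T" using im0 \<phi>t by (simp add: lessThan_Suc)
  have inj: "inj_on \<phi> {..<Suc t}"
    using inj0 im0 \<phi>t f by (simp add: lessThan_Suc)
  define Q where "Q i j = (if j < t then [\<phi> i, \<phi> j] else q (\<phi> i))" for i j
  have pe: "g \<inter> T = {\<phi> i}" if "g \<in> path_edges (Q i j)" "i < j" "j < Suc t" "\<not> j < t" "g \<inter> T \<noteq> {}" for g i j
  proof -
    have "g \<subseteq> set (q (\<phi> i))" using that path_edges_in_set by (auto simp: Q_def)
    moreover have "set (q (\<phi> i)) \<inter> T = {\<phi> i}" using q[OF inT[of i]] that by simp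
    ultimately have "g \<inter> T \<subseteq> {\<phi> i}" by blast
    then show ?thesis using that(5) subset_singletonD by metis
  qed
  show ?thesis
    unfolding odd_clique_def odd_linking_def t_def[symmetric]
  proof (intro exI[of _ \<phi>] exI[of _ Q] conjI)
    show "\<phi> ` {..<Suc t} \<subseteq> V" using im T f by auto
    show "\<forall>i j. i < j \<longrightarrow> j < Suc t \<longrightarrow> walk R (Q i j) \<and> distinct (Q i j) \<and> hd (Q i j) = \<phi> i \<and>
        last (Q i j) = \<phi> j \<and> even (length (Q i j)) \<and> interior (Q i j) \<inter> \<phi> ` {..<Suc t} = {}"
    proof (intro allI impI)
      fix i j assume ij: "i < j" "j < Suc t"
      show "walk R (Q i j) \<and> distinct (Q i j) \<and> hd (Q i j) = \<phi> i \<and>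
        last (Q i j) = \<phi> j \<and> even (length (Q i j)) \<and> interior (Q i j) \<inter> \<phi> ` {..<Suc t} = {}"
      proof (cases "j < t")
        case True
        have "\<phi> i \<noteq> \<phi> j" using inj0 ij True by (auto simp: inj_on_def)
        then show ?thesis
          using True R[of "\<phi> i" "\<phi> j"] inT[of i] inT[of j] ij
          by (auto simp: Q_def walk_Cons interior_def)
      next
        case False
        then have "j = t" "i < t" using ij by auto
        then show ?thesis
          using q[OF inT[of i]] \<phi>t f by (auto simp: Q_def im interior_distinct)
      qed
    qed
    show "\<forall>i j i' j'. i < j \<longrightarrow> j < Suc t \<longrightarrow> i' < j' \<longrightarrow> j' < Suc t \<longrightarrow> (i, j) \<noteq> (i', j') \<longrightarrow>
        path_edges (Q i j) \<inter> path_edges (Q i' j') = {}"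
    proof (intro allI impI)
      have mixed: False if "i < j" "j < t" "i' < Suc t" "i' < t" "g \<in> path_edges (Q i j)" "g \<in> path_edges (Q i' t)" for i j i' g
      proof -
        have g: "g = {\<phi> i, \<phi> j}" using that by (simp add: Q_def)
        then have "g \<inter> T = {\<phi> i, \<phi> j}" using inT that by auto
        moreover have "g \<inter> T = {\<phi> i'}" using pe[OF that(6)] that g inT[of i] by auto
        moreover have "\<phi> i \<noteq> \<phi> j" using inj0 that by (auto simp: inj_on_def)
        ultimately show False by auto
      qed
      fix i j i' j' assume *: "i < j" "j < Suc t" "i' < j'" "j' < Suc t" "(i, j) \<noteq> (i', j')"
      consider "j < t" "j' < t" | "j < t" "j' = t" | "j = t" "j' < t" | "j = t" "j' = t"
        using * by linarith
      then show "path_edges (Q i j) \<inter> path_edges (Q i' j') = {}"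
      proof cases
        case 1
        have "{i, j} \<noteq> {i', j'}" using * by (auto simp: doubleton_eq_iff)
        then have "\<phi> ` {i, j} \<noteq> \<phi> ` {i', j'}"
          using inj_on_image_eq_iff[OF inj, of "{i, j}" "{i', j'}"] * by simp
        then show ?thesis using 1 by (simp add: Q_def)
      next
        case 2
        then show ?thesis using mixed[of i j i'] * by auto
      next
        case 3
        then show ?thesis using mixed[of i' j' i] * by auto
      next
        case 4
        then have "\<phi> i \<noteq> \<phi> i'" using inj0 * by (auto simp: inj_on_def)
        then show ?thesis using disj[OF inT inT, of i i'] 4 * by (simp add: Q_def)
      qed
    qed
  qed (rule inj)
qed

section \<open>Adjacency in line graphs and the case of two colours\<close>

definition line_rel :: "'v set set \<Rightarrow> ('v set \<times> 'v set) set" where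
  "line_rel E = {(e, f). e \<in> E \<and> f \<in> E \<and> e \<noteq> f \<and> e \<inter> f \<noteq> {}}"

lemma line_rel_iff: "(e, f) \<in> line_rel E \<longleftrightarrow> e \<in> E \<and> f \<in> E \<and> e \<noteq> f \<and> e \<inter> f \<noteq> {}"
  by (simp add: line_rel_def)

lemma line_rel_mono: "E \<subseteq> F \<Longrightarrow> line_rel E \<subseteq> line_rel F"
  by (auto simp: line_rel_def)

lemma walk_line_rel: "walk (line_rel E) p \<Longrightarrow> hd p \<in> E \<Longrightarrow> set p \<subseteq> E"
  by (rule walk_set) (auto simp: line_rel_def)

lemma odd_clique_star:
  assumes "finite E"
  shows "odd_clique (line_rel E) E (deg E v)"
  by (rule odd_clique_clique) (auto simp: assms star_def line_rel_def)

lemma critical_ge_2: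
  assumes "critical E k"
  shows "2 \<le> k"
proof -
  obtain u w where uw: "{u, w} \<in> E" "u \<noteq> w" using critical_edge[OF assms] .
  then obtain y where y: "y \<noteq> w" "{u, y} \<in> E" using critical_neighbour[OF assms] by blast
  have fin: "finite E" using assms by (simp add: critical_def simple_edges_def)
  have "card {{u, w}, {u, y}} \<le> deg E u"
    using uw y by (intro card_mono) (auto simp: star_def fin)
  moreover have "{u, w} \<noteq> {u, y}" using y by (auto simp: doubleton_eq_iff)
  moreover have "deg E u \<le> k" using assms by (simp add: critical_def)
  ultimately show ?thesis by simp
qed

text \<open>The terminals are \<open>{x, y}\<close>, a further edge \<open>a\<close> at
  \<open>x\<close> and a further edge \<open>b\<close> at \<open>y\<close>. Every colouring of the
  remaining edges \<open>F\<close> with two colours distinguishes \<open>a\<close> and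
  \<open>b\<close>, as otherwise \<open>{x, y}\<close> could get the other colour. So
  \<open>a\<close> and \<open>b\<close> are joined in the line graph of \<open>F\<close> and, since
  colours alternate, by an odd path.\<close>

lemma odd_clique_critical_2:
  assumes crit: "critical E 2"
  shows "odd_clique (line_rel E) E 3"
proof -
  have E: "simple_edges E" and ncol: "\<not> edge_colourable E 2" and fin: "finite E"
    and d: "\<And>v. deg E v \<le> 2"
    using crit by (auto simp: critical_def simple_edges_def)
  obtain x y where e: "{x, y} \<in> E" "x \<noteq> y" using critical_edge[OF crit] .
  obtain u where u: "u \<noteq> y" "{x, u} \<in> E" using critical_neighbour[OF crit e(1)] by blast
  have "{y, x} \<in> E" using e by (simp add: insert_commute)
  then obtain w where w: "w \<noteq> x" "{y, w} \<in> E" using critical_neighbour[OF crit] by blast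
  define F where "F = E - {{x, y}}"
  define a where "a = {x, u}"
  define b where "b = {y, w}"
  have EF: "E = insert {x, y} F" using e by (auto simp: F_def)
  have ab: "a \<in> F" "b \<in> F" "a \<noteq> b"
    using u w e by (auto simp: F_def a_def b_def doubleton_eq_iff)
  \<comment> \<open>The edge \<open>{x, y}\<close> already takes one of the at most two places at
    \<open>x\<close> and at \<open>y\<close>.\<close>
  have only: "g = h" if "g \<in> F" "h \<in> F" "v \<in> g" "v \<in> h" "v \<in> {x, y}" for g h v
  proof (rule ccontr)
    assume "g \<noteq> h"
    moreover have "g \<noteq> {x, y}" "h \<noteq> {x, y}" using that by (auto simp: F_def)
    ultimately have "card {g, h, {x, y}} = 3" by simp
    moreover have "card {g, h, {x, y}} \<le> deg E v"
      using that EF by (intro card_mono finite_star fin) (auto simp: star_def)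
    ultimately show False using d[of v] by simp
  qed
  have key: "c a \<noteq> c b" if c: "edge_col F 2 c" for c
  proof
    assume eq: "c a = c b"
    have "c a < 2" using c ab by (auto simp: edge_col_def)
    then have other: "1 - c a < 2" "c a \<noteq> 1 - c a" by arith+
    have cx: "c g = c a" if "g \<in> F" "x \<in> g" for g
      using only[OF that(1) ab(1) that(2)] by (auto simp: a_def)
    have cy: "c g = c a" if "g \<in> F" "y \<in> g" for g
      using only[OF that(1) ab(2) that(2)] eq by (auto simp: b_def)
    have "missing F 2 c x (1 - c a)" "missing F 2 c y (1 - c a)"
      using cx cy other unfolding missing_def by metis+
    then show False using edge_colourable_insert[OF c, of x _ y] EF ncol by simp
  qed
  obtain c where c: "edge_col F 2 c"
    using crit e by (auto simp: critical_def edge_colourable_def F_def)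
  let ?R = "line_rel F"
  have c2: "c g < 2" if "g \<in> F" for g using c that by (auto simp: edge_col_def)
  have "\<exists>p. walk ?R p \<and> hd p = a \<and> last p = b"
  proof (rule ccontr)
    assume no: "\<not> ?thesis"
    \<comment> \<open>The component of \<open>a\<close>; exchanging the two colours on it alone
      would make \<open>a\<close> and \<open>b\<close> alike.\<close>
    define D where "D = {g. \<exists>p. walk ?R p \<and> hd p = a \<and> last p = g}"
    have aD: "a \<in> D" unfolding D_def by (intro CollectI exI[of _ "[a]"]) simp
    have bD: "b \<notin> D" using no by (auto simp: D_def)
    have step: "h \<in> D" if g: "g \<in> D" "(g, h) \<in> ?R" for g h
    proof -
      obtain p where p: "walk ?R p" "hd p = a" "last p = g" using g(1) by (auto simp: D_def)
      then have "p \<noteq> []" by (simp add: walk_def)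
      then have "walk ?R (p @ [h])" "hd (p @ [h]) = a" using p g(2) by (auto simp: walk_append)
      then show ?thesis unfolding D_def by (intro CollectI exI[of _ "p @ [h]"]) simp
    qed
    define c' where "c' g = (if g \<in> D then 1 - c g else c g)" for g
    have "edge_col F 2 c'"
      unfolding edge_col_def
    proof (intro conjI ballI impI)
      show "c' ` F \<subseteq> {..<2}" using c2 by (auto simp: c'_def)
      fix g h assume gh: "g \<in> F" "h \<in> F" "g \<noteq> h" "g \<inter> h \<noteq> {}"
      then have "(g, h) \<in> ?R" "(h, g) \<in> ?R" by (auto simp: line_rel_def)
      then have "g \<in> D \<longleftrightarrow> h \<in> D" using step by blast
      moreover have "c g \<noteq> c h" using c gh by (simp add: edge_col_def)
      ultimately show "c' g \<noteq> c' h" using c2[OF gh(1)] c2[OF gh(2)] by (auto simp: c'_def)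
    qed
    moreover have "c' a = c' b" using aD bD key[OF c] c2[OF ab(1)] c2[OF ab(2)] by (auto simp: c'_def)
    ultimately show False using key by blast
  qed
  then obtain p where p: "walk ?R p" "distinct p" "hd p = a" "last p = b"
    using walk_distinct[of ?R] by metis
  have alt: "walk ?R p \<Longrightarrow> c (hd p) = c (last p) \<longleftrightarrow> odd (length p)" for p
  proof (induction p)
    case (Cons g p)
    show ?case
    proof (cases "p = []")
      case False
      then have w: "(g, hd p) \<in> ?R" "walk ?R p" using Cons.prems by (auto simp: walk_Cons)
      then have F: "g \<in> F" "hd p \<in> F" "c g \<noteq> c (hd p)" using c by (auto simp: line_rel_def edge_col_def)
      then have "last p \<in> F" using walk_line_rel[OF w(2)] walk_last_in[OF w(2)] by blast
      then show ?thesis using Cons.IH[OF w(2)] c2[of g] c2[of "hd p"] c2[of "last p"] F False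
        by (auto simp: less_2_cases_iff)
    qed simp
  qed (simp add: walk_def)
  have ev: "even (length p)" using alt[OF p(1)] p key[OF c] by simp
  have pF: "set p \<subseteq> F" using walk_line_rel p ab by metis
  have ep: "{x, y} \<notin> set p" using pF by (auto simp: F_def)
  define q where "q g = (if g = a then p else [{x, y}, b])" for g
  have ne: "{x, y} \<noteq> a" "{x, y} \<noteq> b" using ab by (auto simp: F_def)
  have "odd_clique (line_rel E) E (Suc (card {{x, y}, a}))"
  proof (rule odd_clique_extend[where f = b and q = q])
    fix g assume g: "g \<in> {{x, y}, a}"
    show "walk (line_rel E) (q g) \<and> distinct (q g) \<and> hd (q g) = g \<and> last (q g) = b \<and>
        even (length (q g)) \<and> set (q g) \<inter> {{x, y}, a} = {g}"
    proof (cases "g = a")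
      case True
      have "walk (line_rel E) p" using walk_mono[OF p(1)] line_rel_mono[of F E] EF by blast
      moreover have "a \<in> set p" using p walk_hd_in by metis
      ultimately show ?thesis using True p ev ep by (auto simp: q_def)
    next
      case False
      then show ?thesis using g ne ab e w
        by (auto simp: q_def walk_Cons line_rel_def b_def F_def)
    qed
  next
    fix g h assume "g \<in> {{x, y}, a}" "h \<in> {{x, y}, a}" "g \<noteq> h"
    moreover have "{{x, y}, b} \<notin> path_edges p" using path_edges_in_set[of "{{x, y}, b}" p] ep by auto
    ultimately show "path_edges (q g) \<inter> path_edges (q h) = {}" using ne by (auto simp: q_def)
  qed (use ab ne e in \<open>auto simp: line_rel_def F_def a_def\<close>)
  then show ?thesis using ne by (simp add: numeral_3_eq_3)
qed

text \<open>If \<open>d\<close> is off the path, insert it between \<open>a\<close> and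
  \<open>c\<close>. If it occurs later, both \<open>a\<close>, \<open>d\<close> and
  \<open>a\<close>, \<open>c\<close>, \<open>d\<close> can be continued along the path from
  \<open>d\<close> on, and exactly one of the two lists has even length.\<close>

lemma walk_parity_detour:
  assumes p: "walk R (a # c # p)" "distinct (a # c # p)" "odd (length (a # c # p))"
    and d: "(a, d) \<in> R" "(d, c) \<in> R" "(c, d) \<in> R" "d \<noteq> a" "d \<noteq> c"
  shows "\<exists>q. walk R q \<and> distinct q \<and> hd q = a \<and> last q = last (c # p) \<and> even (length q) \<and>
    set q \<subseteq> insert d (set (a # c # p)) \<and>
    path_edges q \<subseteq> path_edges (a # c # p) \<union> {{a, d}, {c, d}}"
proof (cases "d \<in> set p")
  case False
  have "walk R (a # d # c # p)" using p d by (auto simp: walk_Cons)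
  moreover have "distinct (a # d # c # p)" using p d False by auto
  ultimately show ?thesis
    using p(3) by (intro exI[of _ "a # d # c # p"]) (auto simp: insert_commute)
next
  case True
  then obtain us vs where p': "p = us @ d # vs" by (meson split_list)
  have ca: "walk R (c # p)" "(a, c) \<in> R" using p by (auto simp: walk_Cons)
  have w: "walk R (d # vs)" using walk_split(2)[of R "c # us" d vs] ca by (simp add: p')
  have 1: "walk R (a # d # vs)" "walk R (a # c # d # vs)" using w ca d by (auto simp: walk_Cons)
  have 2: "distinct (a # d # vs)" "distinct (a # c # d # vs)" using p by (auto simp: p')
  have l: "last (d # vs) = last (c # p)" by (simp add: p')
  have 3: "path_edges (d # vs) \<subseteq> path_edges (c # p)" 
    using path_edges_suffix[of "d # vs" "c # us"] by (simp add: p')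
  show ?thesis
  proof (cases "even (length (a # d # vs))")
    case True
    have "path_edges (a # d # vs) \<subseteq> path_edges (a # c # p) \<union> {{a, d}, {c, d}}"
      using 3 by auto
    then show ?thesis using 1 2 l True p' by (intro exI[of _ "a # d # vs"]) auto
  next
    case False
    have "path_edges (a # c # d # vs) \<subseteq> path_edges (a # c # p) \<union> {{a, d}, {c, d}}"
      using 3 by auto
    then show ?thesis using 1 2 l False p' by (intro exI[of _ "a # c # d # vs"]) auto
  qed
qed

text \<open>Let \<open>X\<close> consist of \<open>x\<close> and the ends of all edges that can be
  reached from the star of \<open>x\<close> without meeting \<open>F\<close>. Every edge leaving
  \<open>X\<close> is in \<open>F\<close>, and \<open>y\<close> is not in \<open>X\<close> because
  \<open>F\<close> separates the stars.\<close>

lemma line_rel_separator: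
  assumes fin: "finite E" and xy: "x \<noteq> y"
    and cut: "\<And>X. x \<in> X \<Longrightarrow> y \<notin> X \<Longrightarrow> k \<le> card (edge_cut E X)"
    and F: "finite F" "separator (line_rel E) (star E x) (star E y) F"
  shows "k \<le> card F"
proof -
  let ?R = "line_rel E"
  define D where "D = {e. \<exists>p. walk ?R p \<and> hd p \<in> star E x \<and> last p = e \<and> set p \<inter> F = {}}"
  define X where "X = insert x (\<Union>D)"
  have DE: "D \<subseteq> E"
  proof
    fix e assume "e \<in> D"
    then obtain p where p: "walk ?R p" "hd p \<in> star E x" "last p = e" by (auto simp: D_def)
    then have "set p \<subseteq> E" using walk_line_rel by (auto simp: star_def)
    then show "e \<in> E" using p walk_last_in by blast
  qed
  have "edge_cut E X \<subseteq> F"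
  proof (rule ccontr)
    assume "\<not> edge_cut E X \<subseteq> F"
    then obtain e v where e: "e \<in> E" "\<not> e \<subseteq> X" "e \<notin> F" "v \<in> e" "v \<in> X" by (auto simp: edge_cut_def)
    have "e \<in> D"
    proof (cases "v = x")
      case True
      then show ?thesis using e unfolding D_def
        by (intro CollectI exI[of _ "[e]"]) (auto simp: star_def)
    next
      case False
      then obtain g where g: "g \<in> D" "v \<in> g" using e by (auto simp: X_def)
      then have "g \<noteq> e" using e by (auto simp: X_def)
      then have ge: "(g, e) \<in> ?R" using g DE e by (auto simp: line_rel_def)
      obtain p where p: "walk ?R p" "hd p \<in> star E x" "last p = g" "set p \<inter> F = {}"
        using g(1) by (auto simp: D_def)
      then have "p \<noteq> []" by (simp add: walk_def)
      then have "walk ?R (p @ [e])" "hd (p @ [e]) \<in> star E x" using p ge by (auto simp: walk_append)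
      then show ?thesis using p e unfolding D_def
        by (intro CollectI exI[of _ "p @ [e]"]) auto
    qed
    then show False using e by (auto simp: X_def)
  qed
  have "y \<notin> X"
  proof
    assume "y \<in> X"
    then obtain g where g: "g \<in> D" "y \<in> g" using xy by (auto simp: X_def)
    then have "g \<in> star E y" using DE by (auto simp: star_def)
    moreover obtain p where "walk ?R p" "hd p \<in> star E x" "last p = g" "set p \<inter> F = {}"
      using g(1) by (auto simp: D_def)
    ultimately show False using F(2) by (auto simp: separator_def)
  qed
  then have "k \<le> card (edge_cut E X)" using cut[of X] by (simp add: X_def)
  moreover have "card (edge_cut E X) \<le> card F" using \<open>edge_cut E X \<subseteq> F\<close> by (rule card_mono[OF F(1)])
  ultimately show ?thesis by linarith
qed

text \<open>The terminals are the edges at \<open>x\<close> and the last edge \<open>f\<close> of one of the paths between the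
  stars of \<open>x\<close> and \<open>y\<close>; the last edges of the paths are adjacent to \<open>f\<close>. The parity of a path that
  starts with the edge \<open>a = {x, z}\<close> can be corrected by means of a third edge at \<open>z\<close>. At most
  one \<open>z\<close> lacks such an edge, and then \<open>f\<close> is chosen according to the parity of its path.\<close>

lemma odd_clique_critical_ge_3:
  assumes crit: "critical E k" and k: "3 \<le> k"
  shows "odd_clique (line_rel E) E (Suc k)"
proof -
  have E: "simple_edges E" and fin: "finite E"
    using crit by (auto simp: critical_def simple_edges_def)
  obtain x y where xy: "x \<noteq> y" "deg E x = k" "deg E y = k"
    and cut: "\<And>X. x \<in> X \<Longrightarrow> y \<notin> X \<Longrightarrow> k \<le> card (edge_cut E X)"
    using critical_connected_pair[OF crit] by blast
  let ?R = "line_rel E"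
  define A where "A = star E x"
  define B where "B = star E y"
  have finAB: "finite A" "finite B" and cardAB: "card A = k" "card B = k"
    using fin xy by (simp_all add: A_def B_def)
  have AE: "A \<subseteq> E" "B \<subseteq> E" by (auto simp: A_def B_def star_def)
  have "?R \<subseteq> E \<times> E" by (auto simp: line_rel_def)
  then have finR: "finite ?R" using fin by (meson finite_SigmaI finite_subset)
  obtain \<P> where P: "card \<P> = k" "disjoint_paths ?R A B \<P>"
    using Menger[OF finR finAB, of k] line_rel_separator[OF fin xy(1) cut] unfolding A_def B_def by blast
  have PA: "bij_betw hd \<P> A" "\<And>p. p \<in> \<P> \<Longrightarrow> set p \<inter> A = {hd p}"
    using disjoint_paths_hd[OF P(2) finAB(1)] P(1) cardAB by simp_all
  have PB: "\<And>p. p \<in> \<P> \<Longrightarrow> set p \<inter> B = {last p}"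
    using disjoint_paths_last[OF P(2) finAB(2)] P(1) cardAB by simp
  define P where "P = inv_into \<P> hd"
  have Pa: "P a \<in> \<P>" "hd (P a) = a" if "a \<in> A" for a
    using that PA(1) unfolding P_def bij_betw_def by (auto simp: inv_into_into f_inv_into_f)
  have Pw: "walk ?R (P a)" "distinct (P a)" "last (P a) \<in> B" if "a \<in> A" for a
    using Pa[OF that] P(2) by (auto simp: disjoint_paths_def)
  have PAi: "set (P a) \<inter> A = {a}" if "a \<in> A" for a using PA(2) Pa that by metis
  have Pd: "a = b" if "a \<in> A" "b \<in> A" "g \<in> set (P a)" "g \<in> set (P b)" for a b g
    using Pa that P(2) unfolding disjoint_paths_def by (metis IntI empty_iff)
  have PE: "set (P a) \<subseteq> E" if "a \<in> A" for a
    using walk_line_rel[OF Pw(1)[OF that]] Pa[OF that] AE that by auto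
  have Pl: "last (P a) \<in> set (P a)" if "a \<in> A" for a using Pw[OF that] by simp
  have "\<exists>z. z \<noteq> x \<and> a = {x, z}" if "a \<in> A" for a
    using simple_edges_doubleton[OF E, of a x] that by (auto simp: A_def star_def)
  then obtain z where z: "\<And>a. a \<in> A \<Longrightarrow> z a \<noteq> x" "\<And>a. a \<in> A \<Longrightarrow> a = {x, z a}" by metis
  have zin: "z a \<in> a" if "a \<in> A" for a using z(2)[OF that] by blast
  have z_inj: "a = b" if "a \<in> A" "b \<in> A" "z a = z b" for a b using z(2) that by metis
  \<comment> \<open>The path of \<open>a1\<close> will be \<open>P a1\<close> itself; paths of other
    \<open>a\<close> that do not touch \<open>f\<close> get \<open>f\<close> appended. So where
    \<open>z a\<close> has no third edge, \<open>P a\<close> must have even length for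
    \<open>a1\<close> and odd length otherwise. Only one \<open>z a\<close> can have so small a
    degree; if its list is even, \<open>a1\<close> is that edge.\<close>
  have "\<exists>a1\<in>A. y \<notin> a1 \<and> (\<forall>a\<in>A. deg E (z a) \<le> 2 \<longrightarrow> y \<notin> a \<longrightarrow> (even (length (P a)) \<longleftrightarrow> a = a1))"
  proof (cases "\<exists>a0\<in>A. deg E (z a0) \<le> 2 \<and> y \<notin> a0 \<and> even (length (P a0))")
    case True
    then obtain a0 where a0: "a0 \<in> A" "deg E (z a0) \<le> 2" "y \<notin> a0" "even (length (P a0))" by blast
    have "a = a0" if "a \<in> A" "deg E (z a) \<le> 2" for a
    proof -
      have "{x, z a} \<in> E" "{x, z a0} \<in> E" using z(2) AE that a0(1) by auto
      then show ?thesis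
        using critical_degree_two[OF crit k, of x "z a" "z a0"] that a0 z_inj by blast
    qed
    then show ?thesis using a0 by blast
  next
    case False
    \<comment> \<open>No parity forces the choice here, so \<open>a1\<close> only has to avoid
      \<open>y\<close> and to have an end \<open>v\<close> of degree at least 3.\<close>
    have "\<exists>v. {x, v} \<in> E \<and> v \<noteq> y \<and> deg E v = k"
    proof (cases "{x, y} \<in> E")
      case True
      then show ?thesis using critical_neighbour[OF crit] by blast
    next
      case nxy: False
      have "A \<noteq> {}" using cardAB k by auto
      then obtain a where "a \<in> A" by blast
      then have "{x, z a} \<in> E" using z(2) AE by auto
      then show ?thesis using critical_neighbour[OF crit, of x "z a"] nxy by metis
    qed
    then obtain v where v: "{x, v} \<in> E" "v \<noteq> y" "deg E v = k" by blast
    then have "{x, v} \<in> A" by (simp add: A_def star_def)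
    moreover have "z {x, v} = v" using z[OF calculation] by (metis doubleton_eq_iff)
    ultimately show ?thesis using False v xy(1) k by (intro bexI[of _ "{x, v}"]) auto
  qed
  then obtain a1 where a1: "a1 \<in> A" "y \<notin> a1"
    and a1_even: "\<And>a. a \<in> A \<Longrightarrow> deg E (z a) \<le> 2 \<Longrightarrow> y \<notin> a \<Longrightarrow> even (length (P a)) \<longleftrightarrow> a = a1" by blast
  define f where "f = last (P a1)"
  have fB: "f \<in> B" using Pw[OF a1(1)] by (simp add: f_def)
  then have fE: "f \<in> E" and yf: "y \<in> f" by (auto simp: B_def star_def)
  have fP: "f \<in> set (P a1)" using Pl[OF a1(1)] by (simp add: f_def)
  have fA: "f \<notin> A"
  proof
    assume "f \<in> A"
    then have "f = a1" using PAi[OF a1(1)] fP by blast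
    then show False using yf a1 by simp
  qed
  have xA: "e \<in> A" if "e \<in> E" "x \<in> e" for e using that by (simp add: A_def star_def)
  \<comment> \<open>Classifies the edges \<open>g\<close> of the line graph that the path for
    \<open>a\<close> may use: inside \<open>P a\<close>, at the terminal \<open>a\<close>, the last
    step to \<open>f\<close>, or a detour between two edges at \<open>z a\<close>. Disjointness is
    derived from this classification.\<close>
  define good where "good a g \<longleftrightarrow> g \<subseteq> set (P a) \<or> a \<in> g \<or> (a \<noteq> a1 \<and> g = {last (P a), f}) \<or>
     (y \<notin> a \<and> (\<exists>c d. g = {c, d} \<and> c \<in> set (P a) \<and> c \<noteq> d \<and> c \<in> E \<and> d \<in> E \<and> z a \<in> c \<and> z a \<in> d))"
    for a and g :: "'a set set"
  have "\<exists>q. walk ?R q \<and> distinct q \<and> hd q = a \<and> last q = f \<and> even (length q) \<and> set q \<inter> A = {a} \<and>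
      (\<forall>g\<in>path_edges q. good a g)" if a: "a \<in> A" for a
  proof (cases "f \<inter> a = {}")
    case False
    have "(a, f) \<in> ?R" using False a fA fE AE by (auto simp: line_rel_iff)
    moreover have "a \<noteq> f" using a fA by auto
    ultimately show ?thesis using a fA by (intro exI[of _ "[a, f]"]) (auto simp: walk_Cons good_def)
  next
    case True
    then have ya: "y \<notin> a" using yf by blast
    define r where "r = (if a = a1 then P a else P a @ [f])"
    have ne: "P a \<noteq> []" using Pw[OF a] by (simp add: walk_def)
    have r: "walk ?R r" "distinct r" "hd r = a" "last r = f"
    proof -
      have "f \<notin> set (P a)" if "a \<noteq> a1" using Pd[OF a a1(1) _ fP] that by blast
      moreover have "(last (P a), f) \<in> ?R" if "a \<noteq> a1"
      proof -
        have "last (P a) \<noteq> f" using calculation[OF that] Pl[OF a] by blast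
        moreover have "last (P a) \<in> E" "y \<in> last (P a)" using Pw(3)[OF a] by (auto simp: B_def star_def)
        ultimately show ?thesis using fE yf by (auto simp: line_rel_iff)
      qed
      ultimately show "walk ?R r" "distinct r" "hd r = a" "last r = f"
        using Pw[OF a] Pa[OF a] ne by (auto simp: r_def walk_append f_def)
    qed
    have rs: "set r \<subseteq> insert f (set (P a))" by (auto simp: r_def)
    have "a \<in> set r" using r walk_hd_in by metis
    then have rA: "set r \<inter> A = {a}" using rs PAi[OF a] fA by auto
    have rg: "good a g" if "g \<in> path_edges r" for g
    proof (cases "a = a1")
      case True
      then show ?thesis using that path_edges_in_set[of g "P a"] by (simp add: r_def good_def)
    next
      case False
      then have "g = {last (P a), f} \<or> g \<in> path_edges (P a)"
        using that path_edges_snoc[OF ne] by (auto simp: r_def)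
      then show ?thesis using path_edges_in_set[of g "P a"] False by (auto simp: good_def)
    qed
    show ?thesis
    proof (cases "even (length r)")
      case True
      then show ?thesis using r rA rg by blast
    next
      case odd: False
      \<comment> \<open>So \<open>P a\<close> has a second vertex \<open>c\<close>. It is not in the
        star of \<open>x\<close>, hence meets \<open>a\<close> at \<open>z a\<close>.\<close>
      have "last (P a) \<noteq> a" using Pw(3)[OF a] ya by (auto simp: B_def star_def)
      then obtain c us where cus: "P a = a # c # us"
        using Pa[OF a] ne by (metis last_ConsL list.collapse)
      have "r = a # c # (if a = a1 then us else us @ [f])" using cus unfolding r_def by auto
      then obtain rs where rs': "r = a # c # rs" by blast
      have cP: "c \<in> set (P a)" by (simp add: cus)
      have cE: "c \<in> E" using PE[OF a] cP by blast
      have ca: "c \<noteq> a" using Pw(2)[OF a] by (auto simp: cus)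
      then have cA: "c \<notin> A" using PAi[OF a] cP by blast
      have "(a, c) \<in> ?R" using r(1) rs' by (simp add: walk_Cons)
      then obtain u where u: "u \<in> a" "u \<in> c" by (auto simp: line_rel_iff)
      then have "u \<in> {x, z a}" using z(2)[OF a] by blast
      moreover have "u \<noteq> x" using xA[OF cE] cA u by blast
      ultimately have zc: "z a \<in> c" using u by blast
      \<comment> \<open>If \<open>z a\<close> had no third edge, the choice of \<open>a1\<close>
        would have made the length of \<open>r\<close> even.\<close>
      have "\<not> deg E (z a) \<le> 2"
      proof
        assume "deg E (z a) \<le> 2"
        then have "even (length (P a)) \<longleftrightarrow> a = a1" using a1_even a ya by blast
        then show False using odd by (auto simp: r_def split: if_splits)
      qed
      then have "\<not> star E (z a) \<subseteq> {a, c}"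
        using card_mono[of "{a, c}" "star E (z a)"] ca by auto
      then obtain d where d: "d \<in> E" "z a \<in> d" "d \<noteq> a" "d \<noteq> c" by (auto simp: star_def)
      have dA: "d \<notin> A"
      proof
        assume "d \<in> A"
        then have "{x, z a} \<subseteq> d" using d by (auto simp: A_def star_def)
        moreover have "{x, z a} \<subseteq> a" using z(2)[OF a] by simp
        moreover have "x \<noteq> z a" using z(1)[OF a] by simp
        ultimately show False using simple_edges_eqI[OF E d(1), of a x "z a"] a AE d(3) by blast
      qed
      have "(a, d) \<in> ?R" "(d, c) \<in> ?R" "(c, d) \<in> ?R"
        using a AE d cE zc zin[OF a] by (auto simp: line_rel_iff)
      then obtain q where q: "walk ?R q" "distinct q" "hd q = a" "last q = last (c # rs)"
        "even (length q)" "set q \<subseteq> insert d (set r)" "path_edges q \<subseteq> path_edges r \<union> {{a, d}, {c, d}}"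
        using walk_parity_detour[of ?R a c rs d] r(1,2) odd d(3,4) unfolding rs' by blast
      have "a \<in> set q" using q walk_hd_in by metis
      then have "set q \<inter> A = {a}" using q(6) rA dA by blast
      moreover have "last q = f" using q(4) r(4) rs' by simp
      moreover have "good a g" if gq: "g \<in> path_edges q" for g
      proof -
        consider "g \<in> path_edges r" | "g = {a, d}" | "g = {c, d}" using gq q(7) by blast
        then show ?thesis
        proof cases
          case 3
          then have "\<exists>c d. g = {c, d} \<and> c \<in> set (P a) \<and> c \<noteq> d \<and> c \<in> E \<and> d \<in> E \<and> z a \<in> c \<and> z a \<in> d"
            using cP d cE zc by blast
          then show ?thesis unfolding good_def using ya by simp
        qed (use rg in \<open>simp_all add: good_def\<close>)
      qed
      ultimately show ?thesis using q(1,2,3,5) by blast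
    qed
  qed
  then obtain q where q: "\<And>a. a \<in> A \<Longrightarrow> walk ?R (q a) \<and> distinct (q a) \<and> hd (q a) = a \<and>
      last (q a) = f \<and> even (length (q a)) \<and> set (q a) \<inter> A = {a}"
    and qg: "\<And>a g. a \<in> A \<Longrightarrow> g \<in> path_edges (q a) \<Longrightarrow> good a g" by metis
  have "odd_clique ?R E (Suc (card A))"
  proof (rule odd_clique_extend[where f = f and q = q])
    show "(a, b) \<in> ?R" if "a \<in> A" "b \<in> A" "a \<noteq> b" for a b
      using that by (auto simp: A_def star_def line_rel_iff)
    fix a b assume ab: "a \<in> A" "b \<in> A" "a \<noteq> b"
    have lP: "last (P b) \<notin> set (P a)" if "a \<in> A" "b \<in> A" "a \<noteq> b" for a b
      using Pd[OF that(1,2)] Pl[OF that(2)] that(3) by blast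
    have noin: "b \<notin> g" if "a \<in> A" "b \<in> A" "a \<noteq> b" "g \<in> path_edges (q a)" for a b g
      using q[OF that(1)] path_edges_in_set[OF that(4)] that by blast
    have uniq: "c = d" if "c \<in> E" "d \<in> E" "u \<noteq> v" "u \<in> c" "v \<in> c" "u \<in> d" "v \<in> d" for c d u v
      using simple_edges_eqI[OF E that(1,2,3)] that by blast
    have zz: "z a \<noteq> z b" using z_inj ab by blast
    have By: "last (P a) \<in> E" "y \<in> last (P a)" if "a \<in> A" for a
      using Pw(3)[OF that] by (auto simp: B_def star_def)
    \<comment> \<open>Apart from edges at \<open>b\<close>, every kind of edge that is good for
      \<open>b\<close> contains a vertex of \<open>P b\<close>, so it cannot lie inside
      \<open>P a\<close>.\<close>
    have half: False
      if ab: "a \<in> A" "b \<in> A" "a \<noteq> b" and g: "g \<subseteq> set (P a)" "card g = 2" "a \<notin> g" "b \<notin> g" "good b g"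
      for a b g
    proof -
      have "g \<noteq> {}" using g(2) by auto
      then have "\<exists>h\<in>g. h \<in> set (P b)"
        using g(4,5) Pl[OF ab(2)] unfolding good_def by blast
      then show False using g(1) Pd[OF ab(1,2)] ab(3) by blast
    qed
    show "path_edges (q a) \<inter> path_edges (q b) = {}"
    proof (rule ccontr)
      assume "path_edges (q a) \<inter> path_edges (q b) \<noteq> {}"
      then obtain g where g: "g \<in> path_edges (q a)" "g \<in> path_edges (q b)" by blast
      have c2: "card g = 2" using path_edges_card[OF g(1)] q[OF ab(1)] by simp
      have ng: "a \<notin> g" "b \<notin> g" using noin[OF ab g(1)] noin[OF ab(2,1) _ g(2)] ab(3) by auto
      have ga: "good a g" and gb: "good b g" using qg ab g by blast+
      have ns: "\<not> g \<subseteq> set (P a)" "\<not> g \<subseteq> set (P b)"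
        using half[OF ab] half[OF ab(2,1)] ab(3) c2 ng ga gb by metis+
      have yz: "c = d" if "c \<in> E" "d \<in> E" "y \<in> c" "y \<in> d" "z a \<in> c" "z a \<in> d" "y \<notin> a" "a \<in> A" for a c d
        using uniq[OF that(1,2), of y "z a"] that zin by metis
      \<comment> \<open>Both \<open>last (P b)\<close> and \<open>f\<close> contain
        \<open>y\<close>, and at most one edge joins \<open>y\<close> to \<open>z a\<close>; so a
        detour at \<open>z a\<close> is never a last step.\<close>
      have edge_pair: "c = d" if "g = {c, d}" "g = {last (P b), f}" "z a \<in> c" "z a \<in> d" "y \<notin> a" "a \<in> A" "b \<in> A" for a b c d
      proof -
        have "c \<in> E" "y \<in> c" "d \<in> E" "y \<in> d"
          using that(1,2) By[OF that(7)] fE yf by (metis insertCI insertE singletonD)+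
        then show ?thesis using yz that by blast
      qed
      from ga ng ns consider "a \<noteq> a1" "g = {last (P a), f}"
        | c d where "y \<notin> a" "g = {c, d}" "c \<noteq> d" "c \<in> E" "d \<in> E" "z a \<in> c" "z a \<in> d"
        unfolding good_def by blast
      then show False
      proof cases
        case 1
        from gb ng ns consider "b \<noteq> a1" "g = {last (P b), f}"
          | c d where "y \<notin> b" "g = {c, d}" "c \<noteq> d" "c \<in> E" "d \<in> E" "z b \<in> c" "z b \<in> d"
          unfolding good_def by blast
        then show False
        proof cases
          case 2: 1
          have "last (P a) \<in> {last (P b), f}" using 1 2 by blast
          moreover have "last (P a) \<noteq> last (P b)" using lP[OF ab] Pl[OF ab(1)] by metis
          moreover have "last (P a) \<noteq> f"
            using lP[OF a1(1) ab(1)] 1(1) fP by metis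
          ultimately show False by blast
        next
          case 2
          then show False using edge_pair[of c d a b] 1 ab by blast
        qed
      next
        case a': 2
        from gb ng ns consider "b \<noteq> a1" "g = {last (P b), f}"
          | c d where "y \<notin> b" "g = {c, d}" "c \<noteq> d" "c \<in> E" "d \<in> E" "z b \<in> c" "z b \<in> d"
          unfolding good_def by blast
        then show False
        proof cases
          case 1
          then show False using edge_pair[of c d b a] a' ab by blast
        next
          \<comment> \<open>Two different edges would both join \<open>z a\<close> to
            \<open>z b\<close>.\<close>
          case (2 c' d')
          then have "z b \<in> c" "z b \<in> d" using a'(2) by (auto simp: doubleton_eq_iff)
          then show False using uniq[OF a'(4,5) zz] a' by blast
        qed
      qed
    qed
  qed (use finAB AE fE fA q in auto)
  then show ?thesis using cardAB by simp
qed

text \<open>A common \<open>t\<close> is enough: it bounds the chromatic index from above and is the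
  order of an odd clique, so the chromatic index itself need not be determined.\<close>

theorem simple_odd_clique:
  assumes E: "simple_edges E"
  shows "\<exists>t. edge_colourable E t \<and> odd_clique (line_rel E) E t"
proof -
  have fin: "finite E" using E by (simp add: simple_edges_def)
  have "deg E v < Suc (card E)" for v
    using card_mono[OF fin, of "star E v"] by (auto simp: star_def)
  then obtain v where v: "\<And>w. deg E w \<le> deg E v"
    using ex_has_greatest_nat[of "\<lambda>_. True" undefined "deg E" "Suc (card E)"] by auto
  define k where "k = deg E v"
  show ?thesis
  proof (cases "edge_colourable E k")
    case True
    then show ?thesis using odd_clique_star[OF fin] unfolding k_def by blast
  next
    case False
    obtain F where F: "F \<subseteq> E" "critical F k"
      using exists_critical[OF E _ False] v unfolding k_def by blast
    have "odd_clique (line_rel F) F (Suc k)"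
    proof (cases "k = 2")
      case True
      then show ?thesis using odd_clique_critical_2 F by (simp add: numeral_3_eq_3)
    next
      case False
      then show ?thesis using odd_clique_critical_ge_3 critical_ge_2 F by fastforce
    qed
    then have "odd_clique (line_rel E) E (Suc k)"
      using odd_clique_mono line_rel_mono[OF F(1)] F(1) by blast
    moreover have "edge_colourable E (Suc k)" using Vizing[OF E] v k_def by simp
    ultimately show ?thesis by blast
  qed
qed

subsection \<open>Multiplying vertices\<close>

fun zigzag :: "('a \<Rightarrow> nat \<Rightarrow> 'b) \<Rightarrow> nat \<Rightarrow> nat \<Rightarrow> 'a list \<Rightarrow> 'b list" where
  "zigzag h i j [] = []"
| "zigzag h i j (v # p) = h v i # zigzag h j i p"

lemma length_zigzag [simp]: "length (zigzag h i j p) = length p"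
  by (induction h i j p rule: zigzag.induct) auto

lemma zigzag_eq_Nil [simp]: "zigzag h i j p = [] \<longleftrightarrow> p = []"
  by (cases p) auto

lemma hd_zigzag: "p \<noteq> [] \<Longrightarrow> hd (zigzag h i j p) = h (hd p) i"
  by (cases p) auto

text \<open>On a list of even length, that is on an odd path, the lift ends in copy
  \<open>j\<close>; this is where oddness enters.\<close>

lemma last_zigzag: "p \<noteq> [] \<Longrightarrow> last (zigzag h i j p) = h (last p) (if even (length p) then j else i)"
  by (induction h i j p rule: zigzag.induct) auto

text \<open>\<open>S\<close> contains the graph obtained from \<open>R\<close> by replacing each
  vertex by a clique of \<open>m\<close> copies; \<open>g\<close> projects to the original vertex
  and \<open>h v i\<close> is its copy number \<open>i\<close>.\<close>

locale blow_up =
  fixes R :: "('a \<times> 'a) set" and V :: "'a set" and S :: "('b \<times> 'b) set" and W :: "'b set"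
    and g :: "'b \<Rightarrow> 'a" and h :: "'a \<Rightarrow> nat \<Rightarrow> 'b" and m :: nat
  assumes copies: "\<And>v. v \<in> V \<Longrightarrow> bij_betw (h v) {..<m} {w \<in> W. g w = v}"
    and adj: "\<And>w w'. w \<in> W \<Longrightarrow> w' \<in> W \<Longrightarrow> w \<noteq> w' \<Longrightarrow> g w = g w' \<or> (g w, g w') \<in> R \<Longrightarrow> (w, w') \<in> S"
    and R: "R \<subseteq> V \<times> V" "\<And>v. (v, v) \<notin> R"
begin

lemma h: "v \<in> V \<Longrightarrow> i < m \<Longrightarrow> h v i \<in> W" "v \<in> V \<Longrightarrow> i < m \<Longrightarrow> g (h v i) = v"
  using bij_betwE[OF copies] by auto

lemma h_inj: "v \<in> V \<Longrightarrow> i < m \<Longrightarrow> j < m \<Longrightarrow> h v i = h v j \<Longrightarrow> i = j"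
  using copies unfolding bij_betw_def inj_on_def by blast

lemma map_zigzag: "set p \<subseteq> V \<Longrightarrow> i < m \<Longrightarrow> j < m \<Longrightarrow> map g (zigzag h i j p) = p"
  by (induction p arbitrary: i j) (auto simp: h)

lemma walk_zigzag: "walk R p \<Longrightarrow> set p \<subseteq> V \<Longrightarrow> i < m \<Longrightarrow> j < m \<Longrightarrow> walk S (zigzag h i j p)"
proof (induction p arbitrary: i j)
  case (Cons v p)
  show ?case
  proof (cases "p = []")
    case False
    then have w: "walk R p" "(v, hd p) \<in> R" using Cons.prems by (auto simp: walk_Cons)
    then have V: "v \<in> V" "hd p \<in> V" "v \<noteq> hd p" using R by auto
    have "g (h v i) \<noteq> g (h (hd p) j)" using V h Cons.prems by simp
    then have "h v i \<noteq> h (hd p) j" by metis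
    then have "(h v i, h (hd p) j) \<in> S" using adj h V w Cons.prems by simp
    then show ?thesis using Cons.IH[OF w(1), of j i] Cons.prems False
      by (simp add: walk_Cons hd_zigzag)
  qed simp
qed (simp add: walk_def)

lemma path_edges_zigzag:
  assumes "e \<in> path_edges (zigzag h i j p)" "set p \<subseteq> V" "i < m" "j < m"
  shows "g ` e \<in> path_edges p"
proof -
  obtain k where k: "e = {zigzag h i j p ! k, zigzag h i j p ! Suc k}" "Suc k < length p"
    using assms(1) by (auto simp: path_edges_def)
  have "g (zigzag h i j p ! l) = p ! l" if "l < length p" for l
    using map_zigzag[OF assms(2-4)] that by (metis length_zigzag nth_map)
  then have "g ` e = {p ! k, p ! Suc k}" using k by simp
  then show ?thesis using k(2) by (auto simp: path_edges_def)
qed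

text \<open>Since \<open>p\<close> is distinct, the projection of \<open>e\<close> determines its
  position in \<open>p\<close>; the copies at its two ends then determine both indices.\<close>

lemma zigzag_unique:
  assumes "e \<in> path_edges (zigzag h i j p)" "e \<in> path_edges (zigzag h i' j' p)"
    "set p \<subseteq> V" "distinct p" "i < m" "j < m" "i' < m" "j' < m"
  shows "i = i' \<and> j = j'"
  using assms
proof (induction p arbitrary: i j i' j')
  case (Cons v p)
  obtain w q where p: "p = w # q" using Cons.prems(1) by (cases p) auto
  have V: "v \<in> V" "w \<in> V" "v \<noteq> w" using Cons.prems p by auto
  have notin: "v \<notin> g ` e" if "e \<in> path_edges (zigzag h k l p)" "k < m" "l < m" for k l
  proof -
    have "g ` e \<subseteq> set p"
      using path_edges_in_set[OF path_edges_zigzag[OF that(1) _ that(2,3)]] Cons.prems by simp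
    then show ?thesis using Cons.prems by auto
  qed
  have e: "e = {h v k, h w l} \<or> e \<in> path_edges (zigzag h l k p)"
    if "e \<in> path_edges (zigzag h k l (v # p))" for k l
    using that by (simp add: p)
  have vin: "v \<in> g ` {h v k, h w l}" if "k < m" for k l using h(2)[OF V(1) that] by auto
  consider "e \<in> path_edges (zigzag h j i p)" "e \<in> path_edges (zigzag h j' i' p)"
    | "e = {h v i, h w j}" "e = {h v i', h w j'}"
    using e[OF Cons.prems(1)] e[OF Cons.prems(2)] vin notin Cons.prems(5-8) by metis
  then show ?case
  proof cases
    case 1
    then show ?thesis using Cons.IH[of j i j' i'] Cons.prems by auto
  next
    case 2
    then have eq: "{h v i, h w j} = {h v i', h w j'}" by simp
    have "h v i \<noteq> h w j'" using h(2) V Cons.prems by metis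
    then have "h v i = h v i'" "h w j = h w j'" using eq by (auto simp: doubleton_eq_iff)
    then show ?thesis using h_inj V Cons.prems by metis
  qed
qed simp

text \<open>Copies of one terminal are joined by single edges, which project to one vertex. Lifts of
  different paths of \<open>Q\<close> are disjoint because their projections are, and lifts of the
  same path by \<open>zigzag_unique\<close>.\<close>

lemma odd_clique_blow_up:
  assumes "odd_clique R V t"
  shows "odd_clique S W (m * t)"
proof -
  obtain \<phi> Q where inj: "inj_on \<phi> {..<t}" and \<phi>V: "\<phi> ` {..<t} \<subseteq> V" and Q: "odd_linking R t \<phi> Q"
    using assms unfolding odd_clique_def by auto
  \<comment> \<open>Terminal \<open>n\<close> is copy \<open>n mod m\<close> of the old terminal
    \<open>n div m\<close>.\<close>
  define \<psi> where "\<psi> n = h (\<phi> (n div m)) (n mod m)" for n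
  define P where "P k l = (if k div m = l div m then [\<psi> k, \<psi> l]
    else zigzag h (k mod m) (l mod m) (Q (k div m) (l div m)))" for k l
  have dm: "n div m < t" "n mod m < m" if "n < m * t" for n
  proof -
    have "0 < m" using that by (cases m) auto
    then show "n div m < t" "n mod m < m" using that by (auto simp: less_mult_imp_div_less mult.commute)
  qed
  have \<phi>in: "\<phi> i \<in> V" if "i < t" for i using \<phi>V that by auto
  have \<psi>: "\<psi> n \<in> W" "g (\<psi> n) = \<phi> (n div m)" if "n < m * t" for n
    using h[OF \<phi>in dm(2)] dm that by (auto simp: \<psi>_def)
  have \<phi>eq: "i = j" if "i < t" "j < t" "\<phi> i = \<phi> j" for i j
    using inj that by (auto simp: inj_on_def)
  have \<psi>eq: "k = l" if "k < m * t" "l < m * t" "\<psi> k = \<psi> l" for k l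
  proof -
    have "k div m = l div m" using \<phi>eq dm \<psi>(2) that by metis
    moreover from this have "k mod m = l mod m"
      using h_inj[OF \<phi>in dm(2) dm(2)] dm that by (metis \<psi>_def)
    ultimately show ?thesis by (metis div_mult_mod_eq)
  qed
  have dlt: "k div m < l div m" if "k < l" "k div m \<noteq> l div m" for k l
    using that div_le_mono[of k l m] by simp
  have QV: "set (Q i j) \<subseteq> V" if "i < j" "j < t" for i j
    using walk_set[OF odd_linkingD(1)[OF Q that] R(1)] odd_linkingD(3)[OF Q that] \<phi>in that by simp
  have zz: "walk S (P k l) \<and> distinct (P k l) \<and> hd (P k l) = \<psi> k \<and> last (P k l) = \<psi> l \<and>
      even (length (P k l)) \<and> interior (P k l) \<inter> \<psi> ` {..<m * t} = {}"
    if kl: "k < l" "l < m * t" for k l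
  proof (cases "k div m = l div m")
    case True
    have "\<psi> k \<noteq> \<psi> l" using \<psi>eq[of k l] kl by auto
    moreover have "(\<psi> k, \<psi> l) \<in> S" using adj \<psi> kl True calculation by simp
    ultimately show ?thesis using True by (simp add: P_def walk_Cons interior_def)
  next
    case False
    let ?i = "k div m" and ?j = "l div m"
    have ij: "?i < ?j" "?j < t" using dlt kl False dm by auto
    note q = odd_linkingD[OF Q ij]
    have m: "k mod m < m" "l mod m < m" using dm kl by auto
    have P: "P k l = zigzag h (k mod m) (l mod m) (Q ?i ?j)" using False by (simp add: P_def)
    have ne: "Q ?i ?j \<noteq> []" using q by (simp add: walk_def)
    have mp: "map g (P k l) = Q ?i ?j" using map_zigzag[OF QV[OF ij] m] P by simp
    have d: "distinct (map g (P k l))" using mp q by simp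
    have hl: "hd (P k l) = \<psi> k" "last (P k l) = \<psi> l"
      using hd_zigzag[OF ne] last_zigzag[OF ne] q by (simp_all add: P \<psi>_def)
    have "walk S (P k l)" using walk_zigzag[OF q(1) QV[OF ij] m] P by simp
    moreover have dP: "distinct (P k l)" using d by (simp add: distinct_map)
    \<comment> \<open>An inner terminal would project to an end of \<open>Q ?i ?j\<close>, but
      \<open>g\<close> is injective on the lift, whose own ends already project there.\<close>
    moreover have "interior (P k l) \<inter> \<psi> ` {..<m * t} = {}"
    proof (rule ccontr)
      assume "interior (P k l) \<inter> \<psi> ` {..<m * t} \<noteq> {}"
      then obtain n where n: "n < m * t" "\<psi> n \<in> interior (P k l)" by auto
      then have nP: "\<psi> n \<in> set (P k l)" "\<psi> n \<noteq> \<psi> k" "\<psi> n \<noteq> \<psi> l"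
        using interior_distinct[OF dP] hl by auto
      have nPm: "\<phi> (n div m) \<in> set (Q ?i ?j)"
        using nP(1) mp \<psi>(2)[OF n(1)] by (metis image_eqI list.set_map)
      moreover have "\<phi> (n div m) \<notin> interior (Q ?i ?j)" using q(6) dm[OF n(1)] by auto
      ultimately have "\<phi> (n div m) \<in> {\<phi> ?i, \<phi> ?j}" using interior_distinct[OF q(2)] q(3,4) by auto
      then have "g (\<psi> n) = g (\<psi> k) \<or> g (\<psi> n) = g (\<psi> l)" using \<psi>(2) n kl by auto
      moreover have "P k l \<noteq> []" using ne P by simp
      then have "\<psi> k \<in> set (P k l)" "\<psi> l \<in> set (P k l)" using hl by (metis hd_in_set, metis last_in_set)
      ultimately show False using d nP unfolding distinct_map inj_on_def by metis
    qed
    ultimately show ?thesis using hl q(5) P by simp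
  qed
  have disj: "path_edges (P k l) \<inter> path_edges (P k' l') = {}"
    if kl: "k < l" "l < m * t" "k' < l'" "l' < m * t" "(k, l) \<noteq> (k', l')" for k l k' l'
  proof (rule ccontr)
    assume "path_edges (P k l) \<inter> path_edges (P k' l') \<noteq> {}"
    then obtain e where e: "e \<in> path_edges (P k l)" "e \<in> path_edges (P k' l')" by blast
    have same: "e = {\<psi> k, \<psi> l} \<and> card (g ` e) = 1"
      if "e \<in> path_edges (P k l)" "k div m = l div m" "k < l" "l < m * t" for k l
      using that \<psi>(2)[of k] \<psi>(2)[of l] by (simp add: P_def)
    have diff: "g ` e \<in> path_edges (Q (k div m) (l div m)) \<and> card (g ` e) = 2 \<and>
        e \<in> path_edges (zigzag h (k mod m) (l mod m) (Q (k div m) (l div m)))"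
      if "e \<in> path_edges (P k l)" "k div m \<noteq> l div m" "k < l" "l < m * t" for k l
    proof -
      have ij: "k div m < l div m" "l div m < t" using dlt that dm by auto
      have z: "e \<in> path_edges (zigzag h (k mod m) (l mod m) (Q (k div m) (l div m)))"
        using that by (simp add: P_def)
      moreover have "g ` e \<in> path_edges (Q (k div m) (l div m))"
        using path_edges_zigzag[OF z QV[OF ij]] dm that by simp
      ultimately show ?thesis using path_edges_card odd_linkingD(2)[OF Q ij] by blast
    qed
    \<comment> \<open>The size of the projection of \<open>e\<close>, 1 or 2, tells the two kinds of
      path apart.\<close>
    consider "k div m = l div m" "k' div m = l' div m" | "k div m \<noteq> l div m" "k' div m \<noteq> l' div m"
      using same diff e kl by (metis one_eq_numeral_iff semiring_norm(85))
    then show False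
    proof cases
      case 1
      then have "{\<psi> k, \<psi> l} = {\<psi> k', \<psi> l'}" using same e kl by metis
      then have "k = k' \<and> l = l' \<or> k = l' \<and> l = k'"
        using \<psi>eq kl unfolding doubleton_eq_iff by (meson less_trans)
      then show False using kl by auto
    next
      case 2
      note d = diff[OF e(1) 2(1) kl(1,2)] and d' = diff[OF e(2) 2(2) kl(3,4)]
      have ij: "k div m < l div m" "l div m < t" "k' div m < l' div m" "l' div m < t"
        using dlt dm 2 kl by auto
      have eq: "k div m = k' div m" "l div m = l' div m"
        using odd_linking_disjoint[OF Q ij] d d' by auto
      have m: "k mod m < m" "l mod m < m" "k' mod m < m" "l' mod m < m"
        using dm kl by auto
      have "k mod m = k' mod m \<and> l mod m = l' mod m"
        using zigzag_unique[of e "k mod m" "l mod m" "Q (k div m) (l div m)" "k' mod m" "l' mod m"]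
          d d' eq QV[OF ij(1,2)] odd_linkingD(2)[OF Q ij(1,2)] m by simp
      then show False using eq kl(5) by (metis div_mult_mod_eq)
    qed
  qed
  have "odd_linking S (m * t) \<psi> P"
    unfolding odd_linking_def using zz disj by blast
  moreover have "inj_on \<psi> {..<m * t}" using \<psi>eq by (auto simp: inj_on_def)
  moreover have "\<psi> ` {..<m * t} \<subseteq> W" using \<psi>(1) by auto
  ultimately show ?thesis unfolding odd_clique_def by blast
qed

end

section \<open>From odd cliques to immersions of complete graphs\<close>

lemma odd_clique_immersion:
  assumes "odd_clique R (verts G) n" and R: "\<And>u v. (u, v) \<in> R \<Longrightarrow> {u, v} \<in> edges G"
    and V: "R \<subseteq> verts G \<times> verts G"
  shows "contains_totally_odd_strong_immersion G (complete_graph n)"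
proof -
  obtain \<phi> Q where inj: "inj_on \<phi> {..<n}" and \<phi>V: "\<phi> ` {..<n} \<subseteq> verts G" and Q: "odd_linking R n \<phi> Q"
    using assms(1) unfolding odd_clique_def by auto
  \<comment> \<open>The immersion indexes its paths by unordered pairs; each path runs from the
    smaller index to the larger.\<close>
  define P where "P e = Q (Min e) (Max e)" for e :: "nat set"
  have ex: "\<exists>i j. e = {i, j} \<and> i < j \<and> j < n \<and> P e = Q i j" if "e \<in> edges (complete_graph n)" for e
  proof -
    obtain i j where ij: "e = {i, j}" "i < n" "j < n" "i \<noteq> j"
      using \<open>e \<in> edges (complete_graph n)\<close> by (auto simp: complete_graph_def)
    then consider "i < j" | "j < i" by linarith
    then show ?thesis
    proof cases
      case 1
      then show ?thesis using ij by (intro exI[of _ i] exI[of _ j]) (simp add: P_def)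
    next
      case 2
      then show ?thesis using ij by (intro exI[of _ j] exI[of _ i]) (auto simp: P_def)
    qed
  qed
  have vs: "verts (complete_graph n) = {..<n}" by (simp add: complete_graph_def)
  have "is_path G (P e) \<and> {hd (P e), last (P e)} = \<phi> ` e \<and> interior (P e) \<inter> \<phi> ` {..<n} = {} \<and>
      odd (path_length (P e))" if eC: "e \<in> edges (complete_graph n)" for e
  proof -
    obtain i j where e: "e = {i, j}" "i < j" "j < n" "P e = Q i j" using ex[OF eC] by blast
    note q = odd_linkingD[OF Q e(2,3)]
    have "hd (Q i j) \<in> verts G" using q(3) \<phi>V e by auto
    then have "set (Q i j) \<subseteq> verts G" using walk_set[OF q(1) V] by simp
    moreover have "\<forall>k. Suc k < length (Q i j) \<longrightarrow> {Q i j ! k, Q i j ! Suc k} \<in> edges G"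
      using q(1) R by (auto simp: walk_def successively_conv_nth)
    moreover have "Q i j \<noteq> []" using q(1) by (simp add: walk_def)
    ultimately have "is_path G (P e)" using q(2) by (simp add: is_path_def e(4))
    moreover have "odd (path_length (P e))"
      using q(5) \<open>Q i j \<noteq> []\<close> by (simp add: path_length_def e(4))
    ultimately show ?thesis using q e by auto
  qed
  moreover have "path_edges (P e) \<inter> path_edges (P f) = {}"
    if ef: "e \<in> edges (complete_graph n)" "f \<in> edges (complete_graph n)" "e \<noteq> f" for e f
  proof -
    obtain i j where e: "e = {i, j}" "i < j" "j < n" "P e = Q i j" using ex[OF ef(1)] by blast
    obtain k l where f: "f = {k, l}" "k < l" "l < n" "P f = Q k l" using ex[OF ef(2)] by blast
    have "(i, j) \<noteq> (k, l)" using ef(3) e f by auto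
    then show ?thesis using odd_linking_disjoint[OF Q e(2,3) f(2,3)] e f by simp
  qed
  ultimately show ?thesis
    using inj \<phi>V unfolding contains_totally_odd_strong_immersion_def strong_immersion_def
      immersion_def totally_odd_def vs
    by (intro exI[of _ \<phi>] exI[of _ P]) auto
qed

lemma chromatic_number_le: "proper_colouring G k c \<Longrightarrow> chromatic_number G \<le> k"
  unfolding chromatic_number_def by (rule Least_le) blast

theorem theorem3:
  fixes H :: "('v, 'e) multigraph" and G :: "'e ugraph"
  assumes "loopless_multigraph H"
    and "constant_multiplicity H"
    and "G = line_graph H"
  shows "contains_totally_odd_strong_immersion G (complete_graph (chromatic_number G))"
proof -
  note H = assms(1) and mult = assms(2)
  \<comment> \<open>The underlying simple graph.\<close>
  define E where "E = ends H ` medges H"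
  have fin: "finite (medges H)" using H by (simp add: loopless_multigraph_def)
  have "simple_edges E"
    using H by (auto simp: loopless_multigraph_def simple_edges_def E_def)
  then obtain t where t: "edge_colourable E t" "odd_clique (line_rel E) E t"
    using simple_odd_clique by blast
  obtain m where m: "\<And>u v. u \<in> mverts H \<Longrightarrow> v \<in> mverts H \<Longrightarrow> parallel_edges H u v \<noteq> {} \<Longrightarrow>
      card (parallel_edges H u v) = m"
    using mult unfolding constant_multiplicity_def by blast
  \<comment> \<open>Constant multiplicity gives each edge of \<open>E\<close> exactly
    \<open>m\<close> parallel copies, which \<open>h\<close> numbers.\<close>
  have "\<exists>h. bij_betw h {..<m} {f \<in> medges H. ends H f = e}" if "e \<in> E" for e
  proof -
    obtain f where f: "f \<in> medges H" "ends H f = e" using \<open>e \<in> E\<close> by (auto simp: E_def)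
    then have "card e = 2" "e \<subseteq> mverts H" using H by (auto simp: loopless_multigraph_def)
    then obtain u v where uv: "e = {u, v}" "u \<in> mverts H" "v \<in> mverts H" by (auto simp: card_2_iff)
    then have "card {f \<in> medges H. ends H f = e} = m"
      using m[OF uv(2,3)] f by (auto simp: parallel_edges_def)
    then show ?thesis
      using ex_bij_betw_nat_finite[of "{f \<in> medges H. ends H f = e}"] fin by (simp add: atLeast0LessThan)
  qed
  then obtain h where copies_bij: "\<And>e. e \<in> E \<Longrightarrow> bij_betw (h e) {..<m} {f \<in> medges H. ends H f = e}"
    by metis
  define S where "S = {(e, f). e \<in> medges H \<and> f \<in> medges H \<and> e \<noteq> f \<and> ends H e \<inter> ends H f \<noteq> {}}"
  have ne: "ends H e \<noteq> {}" if "e \<in> medges H" for e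
    using H that by (auto simp: loopless_multigraph_def)
  interpret blow_up "line_rel E" E S "medges H" "ends H" h m
  proof
    fix w w' assume "w \<in> medges H" "w' \<in> medges H" "w \<noteq> w'"
      "ends H w = ends H w' \<or> (ends H w, ends H w') \<in> line_rel E"
    then show "(w, w') \<in> S" using ne[of w] by (auto simp: S_def line_rel_iff)
  qed (use copies_bij in \<open>auto simp: line_rel_def\<close>)
  have clique: "odd_clique S (medges H) (m * t)"
    using t(2) by (rule odd_clique_blow_up)
  obtain c where c: "edge_col E t c" using t(1) unfolding edge_colourable_def by blast
  define idx where "idx f = inv_into {..<m} (h (ends H f)) f" for f
  have idx: "idx f < m" "h (ends H f) (idx f) = f" if "f \<in> medges H" for f
  proof -
    have f: "f \<in> h (ends H f) ` {..<m}"
      using that bij_betw_imp_surj_on[OF copies_bij[OF imageI[OF that, of "ends H", folded E_def]]]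
      by simp
    have "idx f \<in> {..<m}" unfolding idx_def by (rule inv_into_into[OF f])
    then show "idx f < m" by simp
    show "h (ends H f) (idx f) = f" unfolding idx_def by (rule f_inv_into_f[OF f])
  qed
  \<comment> \<open>Since \<open>idx f < m\<close>, this encodes the colour of the underlying edge
    together with the index among its parallel copies as a number below
    \<open>m * t\<close>.\<close>
  define col where "col f = c (ends H f) * m + idx f" for f
  have "proper_colouring (line_graph H) (m * t) col"
    unfolding proper_colouring_def
  proof (intro conjI allI impI)
    show "col ` verts (line_graph H) \<subseteq> {..<m * t}"
    proof (rule image_subsetI)
      fix f assume "f \<in> verts (line_graph H)"
      then have f: "f \<in> medges H" by (simp add: line_graph_def)
      then have "c (ends H f) < t" using c by (auto simp: edge_col_def E_def)
      then have "Suc (c (ends H f)) * m \<le> t * m" by (intro mult_le_mono1) simp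
      then show "col f \<in> {..<m * t}" using idx(1)[OF f] by (simp add: col_def mult.commute)
    qed
    fix e f assume "{e, f} \<in> edges (line_graph H)"
    then have ef: "e \<in> medges H" "f \<in> medges H" "e \<noteq> f" "ends H e \<inter> ends H f \<noteq> {}"
      by (auto simp: line_graph_def doubleton_eq_iff)
    show "col e \<noteq> col f"
    proof
      assume eq: "col e = col f"
      have "c (ends H e) = col e div m" "idx e = col e mod m" "c (ends H f) = col f div m" "idx f = col f mod m"
        using idx(1)[OF ef(1)] idx(1)[OF ef(2)] by (auto simp: col_def)
      then have cc: "c (ends H e) = c (ends H f)" "idx e = idx f" using eq by auto
      then have "ends H e = ends H f" using c ef by (auto simp: edge_col_def E_def)
      then show False using cc idx(2) ef by metis
    qed
  qed
  then have "chromatic_number (line_graph H) \<le> m * t" by (rule chromatic_number_le)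
  \<comment> \<open>The clique has at least as many terminals as colours are necessary; surplus ones
    are dropped.\<close>
  then have "odd_clique S (verts (line_graph H)) (chromatic_number (line_graph H))"
    using odd_clique_mono[OF clique] by (simp add: line_graph_def)
  then show ?thesis
    unfolding \<open>G = line_graph H\<close>
    by (rule odd_clique_immersion) (auto simp: S_def line_graph_def)
qed

end
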